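(* Let $G$ be the simply connected 4-dimensional Lie group whose Lie algebra has a basis $X_1,X_2,X_3,X_4$ with $$[X_1,X_4]=[X_2,X_4]=[X_3,X_4]=0,\quad [X_2,X_3]=X_1,\quad [X_3,X_1]=X_2,\quad [X_1,X_2]=-X_3 .$$ For real numbers $a_1,a_2,a_3$ let $$Y_1=X_1,\quad Y_2=X_2,\quad Y_3=X_3,\quad Y_4=a_1X_1+a_2X_2+a_3X_3+X_4 .$$ Suppose the left-invariant metric $g_0$ on $G$ is diagonal in the basis $Y_i$, i.e. $g_0(Y_i,Y_j)=\lambda_i\delta_{ij}$ with $\lambda_i>0$. Let $g(t)$ be the Ricci flow solution with $g(0)=g_0$. Then: (i) if $\lambda_1\ne\lambda_2$, $g(t)$ remains diagonal in the basis $Y_i$ if and only if $a_1=a_2=a_3=0$; and (ii) if $\lambda_1=\lambda_2$, $g(t)$ remains diagonal in the basis $Y_i$ if and only if $a_1=a_2=0$.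
   Context: Elements of the Lie algebra are identified with left-invariant vector fields on $G$. The Ricci flow solution $g(t)$ is the left-invariant solution of $\frac{\partial}{\partial t}g(t)=-2\operatorname{Ric}(g(t))$, $g(0)=g_0$ (equivalently, the solution of the corresponding ODE on inner products on the Lie algebra). "$g(t)$ remains diagonal in the basis $Y_i$" means $g(t)(Y_i,Y_j)=0$ for all $i\ne j$ and all $t\ge0$ in its maximal interval of existence. *)

theory Defs
  imports "HOL-Analysis.Analysis" "HOL-Algebra.Group"
begin

section \<open>Smooth manifolds given by an atlas\<close>

text \<open>To be used on open sets only: \<open>C_on k S f\<close> says that \<open>f\<close> is of class \<open>C\<^sup>k\<close> on the open set \<open>S\<close>.\<close>

primrec C_on ::
  "nat \<Rightarrow> 'a::euclidean_space set \<Rightarrow> ('a \<Rightarrow> 'b::euclidean_space) \<Rightarrow> bool" where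
  "C_on 0 S f \<longleftrightarrow> continuous_on S f"
| "C_on (Suc k) S f \<longleftrightarrow> f differentiable_on S \<and>
     (\<forall>v. C_on k S (\<lambda>x. frechet_derivative f (at x) v))"

definition smooth_on :: "'a::euclidean_space set \<Rightarrow> ('a \<Rightarrow> 'b::euclidean_space) \<Rightarrow> bool" where
  "smooth_on S f \<longleftrightarrow> (\<forall>k. C_on k S f)"

type_synonym ('g, 'e) chart = "'g set \<times> ('g \<Rightarrow> 'e)"

abbreviation chart_image :: "('g, 'e) chart \<Rightarrow> 'e set" where
  "chart_image c \<equiv> snd c ` fst c"

definition chart_inv :: "('g, 'e) chart \<Rightarrow> 'e \<Rightarrow> 'g" where
  "chart_inv c = inv_into (fst c) (snd c)"

definition is_chart :: "('g::topological_space, 'e::euclidean_space) chart \<Rightarrow> bool" where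
  "is_chart c \<longleftrightarrow> open (fst c) \<and> open (chart_image c) \<and>
     homeomorphism (fst c) (chart_image c) (snd c) (chart_inv c)"

definition smooth_atlas :: "('g::topological_space, 'e::euclidean_space) chart set \<Rightarrow> bool" where
  "smooth_atlas A \<longleftrightarrow> (\<forall>c\<in>A. is_chart c) \<and> (\<Union>c\<in>A. fst c) = UNIV \<and>
     (\<forall>c\<in>A. \<forall>d\<in>A. smooth_on (snd c ` (fst c \<inter> fst d)) (snd d \<circ> chart_inv c))"

definition prod_atlas ::
  "('g, 'e) chart set \<Rightarrow> ('h, 'f) chart set \<Rightarrow> ('g \<times> 'h, 'e \<times> 'f) chart set" where
  "prod_atlas A B = {(fst c \<times> fst d, \<lambda>(p, q). (snd c p, snd d q)) |c d. c \<in> A \<and> d \<in> B}"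

definition smooth_map ::
  "('g::topological_space, 'e::euclidean_space) chart set \<Rightarrow>
   ('h::topological_space, 'f::euclidean_space) chart set \<Rightarrow> ('g \<Rightarrow> 'h) \<Rightarrow> bool" where
  "smooth_map A B F \<longleftrightarrow> continuous_on UNIV F \<and>
     (\<forall>c\<in>A. \<forall>d\<in>B. smooth_on (snd c ` (fst c \<inter> F -` fst d)) (snd d \<circ> F \<circ> chart_inv c))"

definition charts_at :: "('g, 'e) chart set \<Rightarrow> 'g \<Rightarrow> ('g, 'e) chart set" where
  "charts_at A p = {c \<in> A. p \<in> fst c}"

definition chart_at :: "('g, 'e) chart set \<Rightarrow> 'g \<Rightarrow> ('g, 'e) chart" where
  "chart_at A p = (SOME c. c \<in> charts_at A p)"


section \<open>Tangent vectors and vector fields\<close>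

text \<open>
  A tangent vector at \<open>p\<close> is the family of its coordinate representations in the charts around
  \<open>p\<close>, related by the differentials of the coordinate changes; at the other charts the family is
  \<open>0\<close>, so that equality of tangent vectors is equality of functions.
\<close>

type_synonym ('g, 'e) tangent = "('g, 'e) chart \<Rightarrow> 'e"

definition tangent_space ::
  "('g, 'e::euclidean_space) chart set \<Rightarrow> 'g \<Rightarrow> ('g, 'e) tangent set" where
  "tangent_space A p = {v. (\<forall>c. c \<notin> charts_at A p \<longrightarrow> v c = 0) \<and>
     (\<forall>c\<in>charts_at A p. \<forall>d\<in>charts_at A p.
        v d = frechet_derivative (snd d \<circ> chart_inv c) (at (snd c p)) (v c))}"

text \<open>The tangent vector at \<open>p\<close> whose representation in the chart \<open>c\<close> is \<open>u\<close>.\<close>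

definition tangent_of_coords ::
  "('g, 'e::euclidean_space) chart set \<Rightarrow> ('g, 'e) chart \<Rightarrow> 'g \<Rightarrow> 'e \<Rightarrow> ('g, 'e) tangent" where
  "tangent_of_coords A c p u = (\<lambda>d. if d \<in> charts_at A p
     then frechet_derivative (snd d \<circ> chart_inv c) (at (snd c p)) u else 0)"

text \<open>The differential at \<open>p\<close> of a smooth self-map \<open>F\<close>; it does not depend on the chosen chart.\<close>

definition differential ::
  "('g, 'e::euclidean_space) chart set \<Rightarrow> ('g \<Rightarrow> 'g) \<Rightarrow> 'g \<Rightarrow> ('g, 'e) tangent \<Rightarrow> ('g, 'e) tangent"
  where
  "differential A F p v = (let c = chart_at A p in
     (\<lambda>d. if d \<in> charts_at A (F p)
          then frechet_derivative (snd d \<circ> F \<circ> chart_inv c) (at (snd c p)) (v c) else 0))"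

type_synonym ('g, 'e) vector_field = "'g \<Rightarrow> ('g, 'e) tangent"

definition smooth_vector_field ::
  "('g, 'e::euclidean_space) chart set \<Rightarrow> ('g, 'e) vector_field \<Rightarrow> bool" where
  "smooth_vector_field A X \<longleftrightarrow> (\<forall>p. X p \<in> tangent_space A p) \<and>
     (\<forall>c\<in>A. smooth_on (chart_image c) (\<lambda>x. X (chart_inv c x) c))"

definition lie_bracket ::
  "('g, 'e::euclidean_space) chart set \<Rightarrow>
   ('g, 'e) vector_field \<Rightarrow> ('g, 'e) vector_field \<Rightarrow> ('g, 'e) vector_field" where
  "lie_bracket A X Y = (\<lambda>p c. if c \<in> charts_at A p
     then frechet_derivative (\<lambda>x. Y (chart_inv c x) c) (at (snd c p)) (X p c)
        - frechet_derivative (\<lambda>x. X (chart_inv c x) c) (at (snd c p)) (Y p c)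
     else 0)"


section \<open>Riemannian metrics and their Ricci tensor\<close>

text \<open>Only the values of a metric on tangent vectors at the given point are relevant.\<close>

type_synonym ('g, 'e) metric = "'g \<Rightarrow> ('g, 'e) tangent \<Rightarrow> ('g, 'e) tangent \<Rightarrow> real"

definition metric_in_chart ::
  "('g, 'e::euclidean_space) chart set \<Rightarrow> ('g, 'e) metric \<Rightarrow> ('g, 'e) chart \<Rightarrow>
   'e \<Rightarrow> 'e \<Rightarrow> 'e \<Rightarrow> real" where
  "metric_in_chart A g c x u v = (let p = chart_inv c x in
     g p (tangent_of_coords A c p u) (tangent_of_coords A c p v))"

definition riemannian_metric ::
  "('g, 'e::euclidean_space) chart set \<Rightarrow> ('g, 'e) metric \<Rightarrow> bool" where
  "riemannian_metric A g \<longleftrightarrow>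
     (\<forall>p. \<forall>u\<in>tangent_space A p. \<forall>v\<in>tangent_space A p.
        g p u v = g p v u \<and>
        (u \<noteq> (\<lambda>c. 0) \<longrightarrow> g p u u > 0) \<and>
        (\<forall>r. g p (\<lambda>c. r *\<^sub>R u c) v = r * g p u v) \<and>
        (\<forall>w\<in>tangent_space A p. g p (\<lambda>c. u c + v c) w = g p u w + g p v w)) \<and>
     (\<forall>c\<in>A. \<forall>u v. smooth_on (chart_image c) (\<lambda>x. metric_in_chart A g c x u v))"

text \<open>
  In a chart, with \<open>h x\<close> the metric at \<open>x\<close>, the Levi-Civita connection is
  \<open>\<nabla>\<^sub>u V = D V u + \<Gamma>(u, V)\<close>, the curvature tensor on constant fields
  (whose brackets vanish) is \<open>R(u,v)w = \<nabla>\<^sub>u\<nabla>\<^sub>v w - \<nabla>\<^sub>v\<nabla>\<^sub>u w\<close>, and \<open>Ric(v,w)\<close> is the trace of \<open>u \<mapsto> R(u,v)w\<close>.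
\<close>

definition christoffel ::
  "('e::euclidean_space \<Rightarrow> 'e \<Rightarrow> 'e \<Rightarrow> real) \<Rightarrow> 'e \<Rightarrow> 'e \<Rightarrow> 'e \<Rightarrow> 'e" where
  "christoffel h x u v = (THE z. \<forall>w. h x z w =
     (frechet_derivative (\<lambda>y. h y v w) (at x) u
      + frechet_derivative (\<lambda>y. h y u w) (at x) v
      - frechet_derivative (\<lambda>y. h y u v) (at x) w) / 2)"

definition curvature ::
  "('e::euclidean_space \<Rightarrow> 'e \<Rightarrow> 'e \<Rightarrow> real) \<Rightarrow> 'e \<Rightarrow> 'e \<Rightarrow> 'e \<Rightarrow> 'e \<Rightarrow> 'e" where
  "curvature h x u v w =
     frechet_derivative (\<lambda>y. christoffel h y v w) (at x) u
     - frechet_derivative (\<lambda>y. christoffel h y u w) (at x) v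
     + christoffel h x u (christoffel h x v w)
     - christoffel h x v (christoffel h x u w)"

definition ricci_in_coords ::
  "('e::euclidean_space \<Rightarrow> 'e \<Rightarrow> 'e \<Rightarrow> real) \<Rightarrow> 'e \<Rightarrow> 'e \<Rightarrow> 'e \<Rightarrow> real" where
  "ricci_in_coords h x v w = (\<Sum>b\<in>Basis. curvature h x b v w \<bullet> b)"

definition ricci ::
  "('g, 'e::euclidean_space) chart set \<Rightarrow> ('g, 'e) metric \<Rightarrow> ('g, 'e) metric" where
  "ricci A g p v w = (let c = chart_at A p in
     ricci_in_coords (metric_in_chart A g c) (snd c p) (v c) (w c))"


section \<open>Lie groups\<close>

locale lie_group = group G
  for G :: "'g::{t2_space, second_countable_topology} monoid" (structure)
  and A :: "('g, 'e::euclidean_space) chart set" +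
  assumes carrier_UNIV: "carrier G = UNIV"
    and atlas: "smooth_atlas A"
    and smooth_mult: "smooth_map (prod_atlas A A) A (\<lambda>(a, b). a \<otimes> b)"
    and smooth_inverse: "smooth_map A A (m_inv G)"

definition lie_algebra ::
  "'g monoid \<Rightarrow> ('g, 'e::euclidean_space) chart set \<Rightarrow> ('g, 'e) vector_field set" where
  "lie_algebra G A = {X. smooth_vector_field A X \<and>
     (\<forall>a p. X (a \<otimes>\<^bsub>G\<^esub> p) = differential A (\<lambda>q. a \<otimes>\<^bsub>G\<^esub> q) p (X p))}"

definition lie_algebra_basis ::
  "'g monoid \<Rightarrow> ('g, 'e::euclidean_space) chart set \<Rightarrow> nat set \<Rightarrow>
   (nat \<Rightarrow> ('g, 'e) vector_field) \<Rightarrow> bool" where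
  "lie_algebra_basis G A I X \<longleftrightarrow> (\<forall>i\<in>I. X i \<in> lie_algebra G A) \<and>
     (\<forall>Z\<in>lie_algebra G A. \<exists>r. Z = (\<lambda>p c. \<Sum>i\<in>I. r i *\<^sub>R X i p c)) \<and>
     (\<forall>r. (\<lambda>p c. \<Sum>i\<in>I. r i *\<^sub>R X i p c) = (\<lambda>p c. 0) \<longrightarrow> (\<forall>i\<in>I. r i = 0))"

definition left_invariant_metric ::
  "'g monoid \<Rightarrow> ('g, 'e::euclidean_space) chart set \<Rightarrow> ('g, 'e) metric \<Rightarrow> bool" where
  "left_invariant_metric G A g \<longleftrightarrow> riemannian_metric A g \<and>
     (\<forall>a p. \<forall>u\<in>tangent_space A p. \<forall>v\<in>tangent_space A p.
        g (a \<otimes>\<^bsub>G\<^esub> p) (differential A (\<lambda>q. a \<otimes>\<^bsub>G\<^esub> q) p u) (differential A (\<lambda>q. a \<otimes>\<^bsub>G\<^esub> q) p v)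
        = g p u v)"


section \<open>Ricci flow\<close>

definition flow_times :: "ereal \<Rightarrow> real set" where
  "flow_times T = {t. 0 \<le> t \<and> ereal t < T}"

text \<open>At \<open>t = 0\<close> the time derivative is the right one.\<close>

definition left_invariant_ricci_flow ::
  "'g monoid \<Rightarrow> ('g, 'e::euclidean_space) chart set \<Rightarrow> ereal \<Rightarrow> (real \<Rightarrow> ('g, 'e) metric) \<Rightarrow> bool"
  where
  "left_invariant_ricci_flow G A T g \<longleftrightarrow> 0 < T \<and>
     (\<forall>t\<in>flow_times T. left_invariant_metric G A (g t)) \<and>
     (\<forall>t\<in>flow_times T. \<forall>p. \<forall>v\<in>tangent_space A p. \<forall>w\<in>tangent_space A p.
        ((\<lambda>s. g s p v w) has_real_derivative (- 2 * ricci A (g t) p v w))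
          (at t within flow_times T))"

definition metric_eq ::
  "('g, 'e::euclidean_space) chart set \<Rightarrow> ('g, 'e) metric \<Rightarrow> ('g, 'e) metric \<Rightarrow> bool" where
  "metric_eq A g h \<longleftrightarrow>
     (\<forall>p. \<forall>v\<in>tangent_space A p. \<forall>w\<in>tangent_space A p. g p v w = h p v w)"

definition maximal_ricci_flow ::
  "'g monoid \<Rightarrow> ('g, 'e::euclidean_space) chart set \<Rightarrow> ('g, 'e) metric \<Rightarrow>
   ereal \<Rightarrow> (real \<Rightarrow> ('g, 'e) metric) \<Rightarrow> bool" where
  "maximal_ricci_flow G A g0 T g \<longleftrightarrow>
     left_invariant_ricci_flow G A T g \<and> metric_eq A (g 0) g0 \<and>
     (\<forall>T' h. left_invariant_ricci_flow G A T' h \<and> T \<le> T' \<and>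
        (\<forall>t\<in>flow_times T. metric_eq A (h t) (g t)) \<longrightarrow> T' = T)"

definition diagonal_in ::
  "('g, 'e) metric \<Rightarrow> nat set \<Rightarrow> (nat \<Rightarrow> ('g, 'e) vector_field) \<Rightarrow> bool" where
  "diagonal_in g I Y \<longleftrightarrow> (\<forall>i\<in>I. \<forall>j\<in>I. i \<noteq> j \<longrightarrow> (\<forall>p. g p (Y i p) (Y j p) = 0))"

end

theory Submission
  imports Defs
begin

text \<open>
  In a left-invariant frame the Ricci tensor of a left-invariant metric depends on the Gram matrix
  and the structure constants only, so the Ricci flow is an ODE for the Gram matrix. At a diagonal
  Gram matrix with entries \<open>\<mu>\<^sub>i\<close>, the values \<open>Ric(Y\<^sub>i, Y\<^sub>4)\<close> for \<open>i = 1, 2, 3\<close> are negative multiples of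
  \<open>a\<^sub>1 (\<mu>\<^sub>2 + \<mu>\<^sub>3)\<^sup>2\<close>, \<open>a\<^sub>2 (\<mu>\<^sub>1 + \<mu>\<^sub>3)\<^sup>2\<close> and \<open>a\<^sub>3 (\<mu>\<^sub>1 - \<mu>\<^sub>2)\<^sup>2\<close>. If the metric stays diagonal, they
  vanish at time \<open>0\<close>, which gives the conditions on the \<open>a\<^sub>i\<close>. Conversely, under these conditions the
  ODE is tangent to the space of diagonal matrices (with equal first two entries if
  \<open>\<lambda>\<^sub>1 = \<lambda>\<^sub>2\<close>). The distance of the Gram matrix to its projection onto this space satisfies a linear
  differential inequality, because the Ricci tensor is Lipschitz along the solution; hence it
  remains \<open>0\<close>.
\<close>

text \<open>The squares have an algebraic origin. The bracket with \<open>X 3\<close> sends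
  \<open>X 1\<close> to \<open>X 2\<close> and \<open>X 2\<close> to minus \<open>X 1\<close>, so
  for a diagonal metric it is skew exactly when \<mu> 1 = \<mu> 2. The brackets with
  \<open>X 1\<close> and \<open>X 2\<close> act on their planes with equal signs and miss skewness,
  up to sign, by \<mu> 2 + \<mu> 3 and \<mu> 1 + \<mu> 3, which cannot vanish. These defects are the
  squared factors. Hence for nonzero a3 diagonal matrices alone are not preserved: \<mu> 1 = \<mu> 2
  has to be propagated together with the zeros off the diagonal. The converse does not construct a
  diagonal solution and compare, because that solution would have to be shown to live as long as the
  given one. The given solution is compared with its own projection, which need not solve the
  flow.\<close>

section \<open>Symmetry of second derivatives\<close>

text \<open>The mean value theorem is applied in direction \<open>u\<close> only, to the increment
  of \<open>f\<close> by \<open>t *\<^sub>R v\<close>. What remains is an increment of the first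
  derivative, which differentiability at the single point \<open>x\<close> controls. Values are real
  for the sake of the mean value theorem.\<close>

lemma second_difference_limit:
  fixes f :: "'a::real_normed_vector \<Rightarrow> real"
  assumes U: "open U" "x \<in> U"
    and f: "\<And>y. y \<in> U \<Longrightarrow> (f has_derivative f' y) (at y)"
    and g: "((\<lambda>y. f' y u) has_derivative D) (at x)"
  shows "((\<lambda>t. (f (x + t *\<^sub>R u + t *\<^sub>R v) - f (x + t *\<^sub>R u) - f (x + t *\<^sub>R v) + f x) / t\<^sup>2)
           \<longlongrightarrow> D v) (at_right 0)"
proof (rule tendstoI)
  fix e :: real assume e: "e > 0"
  \<comment> \<open>\<open>t * N\<close> bounds every displacement that occurs, and the summand 1
    keeps \<open>N\<close> positive. The tolerance \<open>e / N / 3\<close> below is spent twice,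
    which stays under \<open>e\<close>.\<close>
  define N where "N = 2 * norm u + norm v + 1"
  have N: "N > 0" by (simp add: N_def add_nonneg_pos)
  have lin: "linear D" using g has_derivative_linear by blast
  obtain d1 where d1: "d1 > 0" "\<And>y. norm (y - x) < d1 \<Longrightarrow>
      norm (f' y u - f' x u - D (y - x)) \<le> e / N / 3 * norm (y - x)"
    using g e N unfolding has_derivative_at_alt
    by (metis divide_pos_pos zero_less_numeral)
  obtain d2 where d2: "d2 > 0" "ball x d2 \<subseteq> U"
    using U open_contains_ball by blast
  define d where "d = min d1 d2 / N"
  have "d > 0" using d1 d2 N by (simp add: d_def)
  have "dist ((f (x + t *\<^sub>R u + t *\<^sub>R v) - f (x + t *\<^sub>R u) - f (x + t *\<^sub>R v) + f x) / t\<^sup>2) (D v) < e"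
    if t: "0 < t" "t < d" for t
  proof -
    have tN: "t * N < d1" "t * N < d2"
      using t N by (auto simp: d_def pos_less_divide_eq)
    have small: "norm (s *\<^sub>R u + r *\<^sub>R v) \<le> t * (norm u + norm v)"
      if "0 \<le> s" "s \<le> t" "0 \<le> r" "r \<le> t" for s r
    proof -
      have "norm (s *\<^sub>R u + r *\<^sub>R v) \<le> s * norm u + r * norm v"
        using norm_triangle_ineq[of "s *\<^sub>R u" "r *\<^sub>R v"] that by simp
      also have "\<dots> \<le> t * norm u + t * norm v"
        using that by (intro add_mono mult_right_mono) auto
      finally show ?thesis by (simp add: distrib_left)
    qed
    have le: "t * (norm u + norm v) \<le> t * N"
      using t by (simp add: N_def mult_left_mono)
    have inU: "x + s *\<^sub>R u + r *\<^sub>R v \<in> U" if "0 \<le> s" "s \<le> t" "0 \<le> r" "r \<le> t" for s r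
    proof -
      have "norm (s *\<^sub>R u + r *\<^sub>R v) < d2" using small[OF that] le tN by linarith
      moreover have "dist x (x + w) = norm w" for w by (simp add: dist_norm)
      ultimately have "x + (s *\<^sub>R u + r *\<^sub>R v) \<in> ball x d2" by (simp only: mem_ball)
      then show ?thesis using d2 by (auto simp: add.assoc)
    qed
    define \<phi> where "\<phi> s = f (x + s *\<^sub>R u + t *\<^sub>R v) - f (x + s *\<^sub>R u)" for s
    have fl: "((\<lambda>s. f (x + s *\<^sub>R u + r *\<^sub>R v)) has_real_derivative f' (x + s *\<^sub>R u + r *\<^sub>R v) u) (at s)"
      if "0 \<le> s" "s \<le> t" "0 \<le> r" "r \<le> t" for s r
    proof -
      have "((\<lambda>s. f (x + s *\<^sub>R u + r *\<^sub>R v)) has_derivative (\<lambda>h. f' (x + s *\<^sub>R u + r *\<^sub>R v) (h *\<^sub>R u))) (at s)"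
        by (rule has_derivative_compose[where f = "\<lambda>s. x + s *\<^sub>R u + r *\<^sub>R v" and f' = "\<lambda>h. h *\<^sub>R u"])
          (auto intro!: derivative_eq_intros f inU that)
      moreover have "linear (f' (x + s *\<^sub>R u + r *\<^sub>R v))"
        using f[OF inU[OF that]] has_derivative_linear by blast
      ultimately show ?thesis
        by (simp add: has_field_derivative_def linear_cmul mult_commute_abs)
    qed
    have "\<exists>z>0. z < t \<and> \<phi> t - \<phi> 0 = (t - 0) * (f' (x + z *\<^sub>R u + t *\<^sub>R v) u - f' (x + z *\<^sub>R u) u)"
    proof (rule MVT2)
      fix s assume s: "0 \<le> s" "s \<le> t"
      show "(\<phi> has_real_derivative (f' (x + s *\<^sub>R u + t *\<^sub>R v) u - f' (x + s *\<^sub>R u) u)) (at s)"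
        unfolding \<phi>_def using fl[OF s, of t] fl[OF s, of 0] t by (auto intro!: DERIV_diff)
    qed (use t in auto)
    then obtain z where z: "0 < z" "z < t"
      and eq: "\<phi> t - \<phi> 0 = t * (f' (x + z *\<^sub>R u + t *\<^sub>R v) u - f' (x + z *\<^sub>R u) u)" by auto
    have est: "\<bar>f' (x + z *\<^sub>R u + r *\<^sub>R v) u - f' x u - D (z *\<^sub>R u + r *\<^sub>R v)\<bar>
        \<le> e / N / 3 * (t * N)" if "0 \<le> r" "r \<le> t" for r
    proof -
      have n: "norm (z *\<^sub>R u + r *\<^sub>R v) \<le> t * N" using small[of z r] z that le by linarith
      have "\<bar>f' (x + z *\<^sub>R u + r *\<^sub>R v) u - f' x u - D (z *\<^sub>R u + r *\<^sub>R v)\<bar>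
        \<le> e / N / 3 * norm (z *\<^sub>R u + r *\<^sub>R v)"
        using d1(2)[of "x + z *\<^sub>R u + r *\<^sub>R v"] n tN by (simp add: add.assoc)
      also have "\<dots> \<le> e / N / 3 * (t * N)"
        using n e N by (intro mult_left_mono) auto
      finally show ?thesis .
    qed
    have "D (z *\<^sub>R u + t *\<^sub>R v) = D (z *\<^sub>R u) + t * D v"
      using lin by (simp add: linear_add linear_cmul)
    then have "\<bar>f' (x + z *\<^sub>R u + t *\<^sub>R v) u - f' (x + z *\<^sub>R u) u - t * D v\<bar> \<le> 2 * (e / N / 3 * (t * N))"
      using est[of 0] est[of t] t by simp
    also have "\<dots> < t * e" using t N e by (simp add: field_simps)
    finally have "t * \<bar>f' (x + z *\<^sub>R u + t *\<^sub>R v) u - f' (x + z *\<^sub>R u) u - t * D v\<bar> < t * (t * e)"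
      using t by simp
    then have "\<bar>t * (f' (x + z *\<^sub>R u + t *\<^sub>R v) u - f' (x + z *\<^sub>R u) u) - t\<^sup>2 * D v\<bar> < t\<^sup>2 * e"
      using t abs_mult[of t "f' (x + z *\<^sub>R u + t *\<^sub>R v) u - f' (x + z *\<^sub>R u) u - t * D v"]
      by (simp add: power2_eq_square algebra_simps)
    moreover have "f (x + t *\<^sub>R u + t *\<^sub>R v) - f (x + t *\<^sub>R u) - f (x + t *\<^sub>R v) + f x = \<phi> t - \<phi> 0"
      by (simp add: \<phi>_def)
    ultimately have "\<bar>(f (x + t *\<^sub>R u + t *\<^sub>R v) - f (x + t *\<^sub>R u) - f (x + t *\<^sub>R v) + f x) - t\<^sup>2 * D v\<bar> < t\<^sup>2 * e"
      using eq by simp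
    moreover have "S / t\<^sup>2 - D v = (S - t\<^sup>2 * D v) / t\<^sup>2" for S
      using t by (simp add: field_simps)
    ultimately show ?thesis
      using t by (simp add: dist_real_def divide_less_eq mult.commute abs_divide)
  qed
  then show "\<forall>\<^sub>F t in at_right 0. dist ((f (x + t *\<^sub>R u + t *\<^sub>R v) - f (x + t *\<^sub>R u) - f (x + t *\<^sub>R v) + f x) / t\<^sup>2) (D v) < e"
    using \<open>d > 0\<close> unfolding eventually_at_right_field by auto
qed

text \<open>The second difference is symmetric in \<open>u\<close> and \<open>v\<close>, and both
  mixed derivatives are its limit.\<close>

lemma second_derivative_symmetric:
  fixes f :: "'a::real_normed_vector \<Rightarrow> real"
  assumes "open U" "x \<in> U"
    and "\<And>y. y \<in> U \<Longrightarrow> (f has_derivative f' y) (at y)"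
    and "((\<lambda>y. f' y u) has_derivative D) (at x)"
    and "((\<lambda>y. f' y v) has_derivative D') (at x)"
  shows "D v = D' u"
proof (rule tendsto_unique[OF trivial_limit_at_right_real])
  let ?S = "\<lambda>t. (f (x + t *\<^sub>R u + t *\<^sub>R v) - f (x + t *\<^sub>R u) - f (x + t *\<^sub>R v) + f x) / t\<^sup>2"
  show "(?S \<longlongrightarrow> D v) (at_right 0)"
    using assms by (intro second_difference_limit)
  have "x + t *\<^sub>R u + t *\<^sub>R v = x + t *\<^sub>R v + t *\<^sub>R u" for t by simp
  moreover have "((\<lambda>t. (f (x + t *\<^sub>R v + t *\<^sub>R u) - f (x + t *\<^sub>R v) - f (x + t *\<^sub>R u) + f x) / t\<^sup>2)
      \<longlongrightarrow> D' u) (at_right 0)"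
    using assms by (intro second_difference_limit)
  ultimately show "(?S \<longlongrightarrow> D' u) (at_right 0)"
    by (simp add: algebra_simps)
qed

section \<open>The Ricci tensor in a frame\<close>

lemma bilinear_expand:
  fixes b :: "'a::euclidean_space \<Rightarrow> 'c::euclidean_space \<Rightarrow> 'd::real_vector"
  assumes "bilinear b"
  shows "b v w = (\<Sum>i\<in>Basis. \<Sum>j\<in>Basis. ((v \<bullet> i) * (w \<bullet> j)) *\<^sub>R b i j)"
proof -
  have "b v w = b (\<Sum>i\<in>Basis. (v \<bullet> i) *\<^sub>R i) (\<Sum>j\<in>Basis. (w \<bullet> j) *\<^sub>R j)"
    by (simp only: euclidean_representation)
  also have "\<dots> = (\<Sum>(i, j)\<in>Basis \<times> Basis. b ((v \<bullet> i) *\<^sub>R i) ((w \<bullet> j) *\<^sub>R j))"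
    by (rule bilinear_sum[OF assms])
  finally show ?thesis
    by (simp add: bilinear_lmul[OF assms] bilinear_rmul[OF assms] sum.cartesian_product mult.commute)
qed

text \<open>Differentiability of \<open>b\<close> is known for constant arguments only. Expanding
  both arguments in \<open>Basis\<close> reduces moving arguments to finitely many products of
  scalar functions with such terms.\<close>

lemma
  fixes b :: "'e::real_normed_vector \<Rightarrow> 'a::euclidean_space \<Rightarrow> 'c::euclidean_space \<Rightarrow> 'd::real_normed_vector"
  assumes U: "open U" "x \<in> U"
    and b: "\<And>y. y \<in> U \<Longrightarrow> bilinear (b y)"
    and diff: "\<And>v w. (\<lambda>y. b y v w) differentiable (at x)"
  shows bilinear_frechet_derivative:
      "bilinear (\<lambda>v w. frechet_derivative (\<lambda>y. b y v w) (at x) u)" (is ?bilinear)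
    and has_derivative_bilinear_field:
      "(V has_derivative V') (at x) \<Longrightarrow> (W has_derivative W') (at x) \<Longrightarrow>
       ((\<lambda>y. b y (V y) (W y)) has_derivative
         (\<lambda>u. frechet_derivative (\<lambda>y. b y (V x) (W x)) (at x) u + b x (V' u) (W x) + b x (V x) (W' u))) (at x)"
proof -
  define D where "D i j = frechet_derivative (\<lambda>y. b y i j) (at x)" for i j
  have D: "((\<lambda>y. b y i j) has_derivative D i j) (at x)" for i j
    using diff unfolding D_def by (simp flip: frechet_derivative_works)
  have expand: "((\<lambda>y. b y (V y) (W y)) has_derivative
      (\<lambda>u. \<Sum>i\<in>Basis. \<Sum>j\<in>Basis. ((V x \<bullet> i) * (W x \<bullet> j)) *\<^sub>R D i j u
        + ((V x \<bullet> i) * (W' u \<bullet> j) + (V' u \<bullet> i) * (W x \<bullet> j)) *\<^sub>R b x i j)) (at x)"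
    if "(V has_derivative V') (at x)" "(W has_derivative W') (at x)" for V W V' W'
  proof (rule has_derivative_transform_within_open[OF _ U])
    show "((\<lambda>y. \<Sum>i\<in>Basis. \<Sum>j\<in>Basis. ((V y \<bullet> i) * (W y \<bullet> j)) *\<^sub>R b y i j) has_derivative
      (\<lambda>u. \<Sum>i\<in>Basis. \<Sum>j\<in>Basis. ((V x \<bullet> i) * (W x \<bullet> j)) *\<^sub>R D i j u
        + ((V x \<bullet> i) * (W' u \<bullet> j) + (V' u \<bullet> i) * (W x \<bullet> j)) *\<^sub>R b x i j)) (at x)"
      by (auto intro!: has_derivative_sum has_derivative_scaleR has_derivative_mult
          has_derivative_inner_left that D)
  qed (simp add: bilinear_expand[OF b])
  have const: "frechet_derivative (\<lambda>y. b y v w) (at x) u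
      = (\<Sum>i\<in>Basis. \<Sum>j\<in>Basis. ((v \<bullet> i) * (w \<bullet> j)) *\<^sub>R D i j u)" for v w u
    using fun_cong[OF frechet_derivative_at[OF expand[OF has_derivative_const[of v] has_derivative_const[of w]]], of u]
    by simp
  show ?bilinear
    by (simp add: const bilinear_def linear_iff sum.distrib scaleR_right.sum scaleR_add_left algebra_simps)
  show "((\<lambda>y. b y (V y) (W y)) has_derivative
         (\<lambda>u. frechet_derivative (\<lambda>y. b y (V x) (W x)) (at x) u + b x (V' u) (W x) + b x (V x) (W' u))) (at x)"
    if "(V has_derivative V') (at x)" "(W has_derivative W') (at x)"
    using expand[OF that] unfolding const
    by (simp add: bilinear_expand[OF b[OF U(2)], of "V' _"] bilinear_expand[OF b[OF U(2)], of _ "W' _"]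
        sum.distrib scaleR_add_left algebra_simps)
qed

text \<open>
  With Gram matrix \<open>G\<close>, its inverse \<open>H\<close> and structure constants \<open>c\<close>, the Koszul formula gives the
  coefficient of \<open>E\<^sub>k\<close> in \<open>\<nabla>\<^sub>i E\<^sub>j\<close>.
\<close>

definition frame_connection ::
  "('n::finite \<Rightarrow> 'n \<Rightarrow> real) \<Rightarrow> ('n \<Rightarrow> 'n \<Rightarrow> real) \<Rightarrow> ('n \<Rightarrow> 'n \<Rightarrow> 'n \<Rightarrow> real) \<Rightarrow> 'n \<Rightarrow> 'n \<Rightarrow> 'n \<Rightarrow> real"
  where "frame_connection G H c i j k =
    (\<Sum>m\<in>UNIV. H k m * (\<Sum>l\<in>UNIV. c i j l * G l m - c j m l * G l i + c m i l * G l j) / 2)"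

text \<open>The trace over \<open>a\<close> of the curvature applied to the frame vectors
  \<open>a\<close>, \<open>j\<close>, \<open>k\<close>. Connection coefficients are constant, so
  none of their derivatives appears; the last term is the covariant derivative along the bracket of
  \<open>a\<close> and \<open>j\<close>.\<close>

definition frame_ricci ::
  "('n::finite \<Rightarrow> 'n \<Rightarrow> real) \<Rightarrow> ('n \<Rightarrow> 'n \<Rightarrow> real) \<Rightarrow> ('n \<Rightarrow> 'n \<Rightarrow> 'n \<Rightarrow> real) \<Rightarrow> 'n \<Rightarrow> 'n \<Rightarrow> real"
  where "frame_ricci G H c j k = (\<Sum>a\<in>UNIV. \<Sum>l\<in>UNIV.
      frame_connection G H c j k l * frame_connection G H c a l a
      - frame_connection G H c a k l * frame_connection G H c j l a
      - c a j l * frame_connection G H c l k a)"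

text \<open>A left-invariant frame read in one chart. Homogeneity enters through \<open>gram\<close>
  and \<open>bracket\<close>, whose coefficients \<open>G\<close> and \<open>c\<close> do not depend
  on the point.\<close>

locale homogeneous_frame =
  fixes U :: "'e::euclidean_space set" and h :: "'e \<Rightarrow> 'e \<Rightarrow> 'e \<Rightarrow> real"
    and E :: "'n::finite \<Rightarrow> 'e \<Rightarrow> 'e"
    and G H :: "'n \<Rightarrow> 'n \<Rightarrow> real" and c :: "'n \<Rightarrow> 'n \<Rightarrow> 'n \<Rightarrow> real"
  assumes open_U: "open U"
    and bilinear_h: "\<And>x. x \<in> U \<Longrightarrow> bilinear (h x)"
    and sym_h: "\<And>x u v. x \<in> U \<Longrightarrow> h x u v = h x v u"
    and diff_h: "\<And>x u v. x \<in> U \<Longrightarrow> (\<lambda>y. h y u v) differentiable (at x)"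
    and diff_E: "\<And>x i. x \<in> U \<Longrightarrow> E i differentiable (at x)"
    and diff2_E: "\<And>x i v. x \<in> U \<Longrightarrow> (\<lambda>y. frechet_derivative (E i) (at y) v) differentiable (at x)"
    and gram: "\<And>x i j. x \<in> U \<Longrightarrow> h x (E i x) (E j x) = G i j"
    and inverse: "\<And>i j. (\<Sum>m\<in>UNIV. H i m * G m j) = (if i = j then 1 else 0)"
    and inverse': "\<And>i j. (\<Sum>m\<in>UNIV. G i m * H m j) = (if i = j then 1 else 0)"
    and spanning: "\<And>x. x \<in> U \<Longrightarrow> span (range (\<lambda>i. E i x)) = UNIV"
    and bracket: "\<And>x i j. x \<in> U \<Longrightarrow>
      frechet_derivative (E j) (at x) (E i x) - frechet_derivative (E i) (at x) (E j x)
      = (\<Sum>k\<in>UNIV. c i j k *\<^sub>R E k x)"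
begin

abbreviation dE :: "'n \<Rightarrow> 'e \<Rightarrow> 'e \<Rightarrow> 'e" where
  "dE i x v \<equiv> frechet_derivative (E i) (at x) v"

abbreviation \<gamma> :: "'n \<Rightarrow> 'n \<Rightarrow> 'n \<Rightarrow> real" where
  "\<gamma> \<equiv> frame_connection G H c"

text \<open>
  The coframe \<open>\<theta>\<close> dual to \<open>E\<close>, the connection forms \<open>\<omega>\<close>, and the Christoffel symbols \<open>\<Gamma>\<close> obtained by
  solving \<open>\<nabla>\<^sub>v E\<^sub>k = DE\<^sub>k v + \<Gamma>(v, E\<^sub>k) = \<Sum>\<^sub>l \<omega>\<^sub>k\<^sub>l(v) E\<^sub>l\<close>.
\<close>

definition \<theta> :: "'n \<Rightarrow> 'e \<Rightarrow> 'e \<Rightarrow> real" where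
  "\<theta> i x v = (\<Sum>m\<in>UNIV. H i m * h x v (E m x))"

definition \<omega> :: "'n \<Rightarrow> 'n \<Rightarrow> 'e \<Rightarrow> 'e \<Rightarrow> real" where
  "\<omega> k l x v = (\<Sum>i\<in>UNIV. \<theta> i x v * \<gamma> i k l)"

definition \<Gamma> :: "'e \<Rightarrow> 'e \<Rightarrow> 'e \<Rightarrow> 'e" where
  "\<Gamma> x v w = (\<Sum>k\<in>UNIV. \<theta> k x w *\<^sub>R ((\<Sum>l\<in>UNIV. \<omega> k l x v *\<^sub>R E l x) - dE k x v))"

lemma has_derivative_E: "x \<in> U \<Longrightarrow> (E i has_derivative dE i x) (at x)"
  using diff_E frechet_derivative_works by blast

lemma linear_dE: "x \<in> U \<Longrightarrow> linear (dE i x)"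
  using has_derivative_E has_derivative_linear by blast

lemma linear_h: "x \<in> U \<Longrightarrow> linear (\<lambda>v. h x v w)" "x \<in> U \<Longrightarrow> linear (h x v)"
  using bilinear_h[of x] by (auto simp: bilinear_def)

lemma linear_\<theta>: "x \<in> U \<Longrightarrow> linear (\<theta> i x)"
  using linear_h(1)[of x] unfolding \<theta>_def linear_iff
  by (simp add: sum.distrib sum_distrib_left algebra_simps)

lemma linear_\<omega>: "x \<in> U \<Longrightarrow> linear (\<omega> k l x)"
  using linear_\<theta>[of x] unfolding \<omega>_def linear_iff
  by (simp add: sum.distrib sum_distrib_left algebra_simps)

lemma \<theta>_E: "x \<in> U \<Longrightarrow> \<theta> i x (E j x) = (if i = j then 1 else 0)"
  using inverse[of i j] sym_h[of x "E j x"] by (simp add: \<theta>_def gram)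

lemma \<omega>_E: "x \<in> U \<Longrightarrow> \<omega> k l x (E j x) = \<gamma> j k l"
  by (simp add: \<omega>_def \<theta>_E if_distrib[of "\<lambda>x. x * _"] cong: if_cong)

lemma linear_eqI:
  assumes "x \<in> U" "linear f" "linear g" "\<And>i. f (E i x) = g (E i x)"
  shows "f v = g v"
  using linear_eq_on_span[OF assms(2,3), of "range (\<lambda>i. E i x)" v] assms spanning by auto

lemma frame_expand: "x \<in> U \<Longrightarrow> v = (\<Sum>i\<in>UNIV. \<theta> i x v *\<^sub>R E i x)"
proof (rule linear_eqI[of x "\<lambda>v. v"])
  assume x: "x \<in> U"
  show "linear (\<lambda>v. v)" by (rule linear_ident)
  show "linear (\<lambda>v. \<Sum>i\<in>UNIV. \<theta> i x v *\<^sub>R E i x)"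
    using linear_\<theta>[OF x] by (auto simp: linear_iff sum.distrib scaleR_right.sum scaleR_add_left)
  show "E i x = (\<Sum>j\<in>UNIV. \<theta> j x (E i x) *\<^sub>R E j x)" for i
    by (simp add: \<theta>_E x if_distrib[of "\<lambda>x. x *\<^sub>R _"] cong: if_cong)
qed

lemma bilinear_\<Gamma>: assumes x: "x \<in> U" shows "bilinear (\<Gamma> x)"
proof -
  have "linear (\<lambda>v. \<Gamma> x v w)" for w
    using linear_\<omega>[OF x] linear_dE[OF x] unfolding \<Gamma>_def linear_iff
    by (simp add: sum.distrib scaleR_right.sum scaleR_add_left sum_subtractf algebra_simps)
  moreover have "linear (\<Gamma> x v)" for v
    using linear_\<theta>[OF x] unfolding \<Gamma>_def linear_iff
    by (simp add: sum.distrib scaleR_right.sum scaleR_add_left)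
  ultimately show ?thesis by (simp add: bilinear_def)
qed

lemma \<Gamma>_E: "x \<in> U \<Longrightarrow> \<Gamma> x v (E k x) = (\<Sum>l\<in>UNIV. \<omega> k l x v *\<^sub>R E l x) - dE k x v"
  by (simp add: \<Gamma>_def \<theta>_E if_distrib[of "\<lambda>x. x *\<^sub>R _"] cong: if_cong)

lemma diff_\<theta>: "x \<in> U \<Longrightarrow> (\<lambda>y. \<theta> i y v) differentiable (at x)"
proof -
  assume x: "x \<in> U"
  have "(\<lambda>y. h y v (E m y)) differentiable (at x)" for m
    using has_derivative_bilinear_field[OF open_U x bilinear_h diff_h[OF x] has_derivative_const has_derivative_E[OF x]]
    unfolding differentiable_def by blast
  then show ?thesis unfolding \<theta>_def by simp
qed

lemma diff_\<omega>: "x \<in> U \<Longrightarrow> (\<lambda>y. \<omega> k l y v) differentiable (at x)"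
  unfolding \<omega>_def by (simp add: diff_\<theta>)

lemma diff_\<Gamma>: "x \<in> U \<Longrightarrow> (\<lambda>y. \<Gamma> y v w) differentiable (at x)"
  unfolding \<Gamma>_def by (simp add: diff_\<theta> diff_\<omega> diff_E diff2_E)

text \<open>Products of frame fields are constant, so the product rule trades derivatives of the
  metric for derivatives of the frame.\<close>

lemma dh_E:
  assumes x: "x \<in> U"
  shows "frechet_derivative (\<lambda>y. h y (E i x) (E j x)) (at x) u
    = - h x (dE i x u) (E j x) - h x (E i x) (dE j x u)"
proof -
  have "((\<lambda>y. h y (E i y) (E j y)) has_derivative (\<lambda>u. 0)) (at x)"
    by (rule has_derivative_transform_within_open[OF has_derivative_const open_U x]) (simp add: gram)
  from has_derivative_unique[OF this
      has_derivative_bilinear_field[OF open_U x bilinear_h diff_h[OF x] has_derivative_E[OF x] has_derivative_E[OF x]]]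
  have "frechet_derivative (\<lambda>y. h y (E i x) (E j x)) (at x) u
      + h x (dE i x u) (E j x) + h x (E i x) (dE j x u) = 0"
    by (rule fun_cong[OF sym])
  then show ?thesis by linarith
qed

lemma gram_connection:
  assumes x: "x \<in> U"
  shows "(\<Sum>l\<in>UNIV. \<gamma> i j l * G l k)
    = (\<Sum>l\<in>UNIV. c i j l * G l k - c j k l * G l i + c k i l * G l j) / 2"
proof -
  define K where "K m = (\<Sum>l\<in>UNIV. c i j l * G l m - c j m l * G l i + c m i l * G l j) / 2" for m
  have sym: "G l k = G k l" for l
    using gram[OF x, of l k] gram[OF x, of k l] sym_h[OF x] by metis
  have "(\<Sum>l\<in>UNIV. \<gamma> i j l * G l k) = (\<Sum>l\<in>UNIV. \<Sum>m\<in>UNIV. G k l * H l m * K m)"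
    by (simp add: frame_connection_def K_def sym sum_distrib_left sum_distrib_right mult_ac)
  also have "\<dots> = (\<Sum>m\<in>UNIV. (\<Sum>l\<in>UNIV. G k l * H l m) * K m)"
    by (subst sum.swap) (simp add: sum_distrib_right)
  also have "\<dots> = K k"
    by (simp add: inverse' if_distrib[of "\<lambda>x. x * _"] cong: if_cong)
  finally show ?thesis by (simp add: K_def)
qed

text \<open>Both sides become combinations of products of \<open>dE\<close> with frame vectors: the
  left through the brackets in the Koszul formula, the right through \<open>dh_E\<close>. Symmetry
  of \<open>h\<close> matches them.\<close>

lemma koszul_E:
  assumes x: "x \<in> U"
  shows "h x (\<Gamma> x (E i x) (E j x)) (E k x) =
     (frechet_derivative (\<lambda>y. h y (E j x) (E k x)) (at x) (E i x)
      + frechet_derivative (\<lambda>y. h y (E i x) (E k x)) (at x) (E j x)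
      - frechet_derivative (\<lambda>y. h y (E i x) (E j x)) (at x) (E k x)) / 2"
proof -
  note lin = linear_h(1)[OF x]
  have cG: "(\<Sum>l\<in>UNIV. c a b l * G l d) = h x (dE b x (E a x)) (E d x) - h x (dE a x (E b x)) (E d x)" for a b d
  proof -
    have "(\<Sum>l\<in>UNIV. c a b l * G l d) = h x (\<Sum>l\<in>UNIV. c a b l *\<^sub>R E l x) (E d x)"
      by (simp add: linear_sum[OF lin] linear_cmul[OF lin] gram x)
    then show ?thesis by (simp add: linear_diff[OF lin] flip: bracket[OF x])
  qed
  have "h x (\<Gamma> x (E i x) (E j x)) (E k x) = (\<Sum>l\<in>UNIV. \<gamma> i j l * G l k) - h x (dE j x (E i x)) (E k x)"
    by (simp add: \<Gamma>_E \<omega>_E x linear_diff[OF lin] linear_sum[OF lin] linear_cmul[OF lin] gram)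
  also have "\<dots> = ((\<Sum>l\<in>UNIV. c i j l * G l k) - (\<Sum>l\<in>UNIV. c j k l * G l i) + (\<Sum>l\<in>UNIV. c k i l * G l j)) / 2
      - h x (dE j x (E i x)) (E k x)"
    by (simp add: gram_connection[OF x] sum.distrib sum_subtractf)
  finally show ?thesis
    unfolding cG dh_E[OF x] by (simp add: sym_h[OF x, of "E _ x"] field_simps)
qed

text \<open>Both sides are trilinear, so the identity passes from frame vectors to arbitrary ones,
  one argument at a time.\<close>

lemma koszul:
  assumes x: "x \<in> U"
  shows "h x (\<Gamma> x u v) w =
     (frechet_derivative (\<lambda>y. h y v w) (at x) u
      + frechet_derivative (\<lambda>y. h y u w) (at x) v
      - frechet_derivative (\<lambda>y. h y u v) (at x) w) / 2"
proof -
  note bil = bilinear_frechet_derivative[OF open_U x bilinear_h diff_h[OF x]]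
  have "linear (frechet_derivative (\<lambda>y. h y v w) (at x))" for v w
    using linear_frechet_derivative[OF diff_h[OF x]] .
  note lin = this[THEN linear_add] this[THEN linear_cmul] linear_add[OF linear_h(1)[OF x]]
    linear_cmul[OF linear_h(1)[OF x]] linear_add[OF linear_h(2)[OF x]] linear_cmul[OF linear_h(2)[OF x]]
    bilinear_ladd[OF bil] bilinear_radd[OF bil] bilinear_lmul[OF bil] bilinear_rmul[OF bil]
    bilinear_ladd[OF bilinear_\<Gamma>[OF x]] bilinear_radd[OF bilinear_\<Gamma>[OF x]]
    bilinear_lmul[OF bilinear_\<Gamma>[OF x]] bilinear_rmul[OF bilinear_\<Gamma>[OF x]]
  let ?K = "\<lambda>u v w. (frechet_derivative (\<lambda>y. h y v w) (at x) u
      + frechet_derivative (\<lambda>y. h y u w) (at x) v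
      - frechet_derivative (\<lambda>y. h y u v) (at x) w) / 2"
  have 1: "h x (\<Gamma> x (E i x) (E j x)) w = ?K (E i x) (E j x) w" for i j w
    by (rule linear_eqI[OF x, of "\<lambda>w. h x (\<Gamma> x (E i x) (E j x)) w" "\<lambda>w. ?K (E i x) (E j x) w"])
      (simp_all add: koszul_E[OF x] linear_iff lin field_simps)
  have 2: "h x (\<Gamma> x (E i x) v) w = ?K (E i x) v w" for i v w
    by (rule linear_eqI[OF x, of "\<lambda>v. h x (\<Gamma> x (E i x) v) w" "\<lambda>v. ?K (E i x) v w"])
      (simp_all add: 1 linear_iff lin field_simps)
  show ?thesis
    by (rule linear_eqI[OF x, of "\<lambda>u. h x (\<Gamma> x u v) w" "\<lambda>u. ?K u v w"])
      (simp_all add: 2 linear_iff lin field_simps)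
qed

text \<open>Through \<theta> a vector is determined by its products with the frame, which gives the
  uniqueness that \<open>THE\<close> demands.\<close>

lemma christoffel_eq:
  assumes x: "x \<in> U"
  shows "christoffel h x v w = \<Gamma> x v w"
  unfolding christoffel_def
proof (rule the_equality)
  fix z assume "\<forall>w'. h x z w' = (frechet_derivative (\<lambda>y. h y w w') (at x) v
      + frechet_derivative (\<lambda>y. h y v w') (at x) w - frechet_derivative (\<lambda>y. h y v w) (at x) w') / 2"
  then have "h x z w' = h x (\<Gamma> x v w) w'" for w'
    by (simp add: koszul[OF x])
  then have "\<theta> i x z = \<theta> i x (\<Gamma> x v w)" for i
    by (simp add: \<theta>_def)
  then have "(\<Sum>i\<in>UNIV. \<theta> i x z *\<^sub>R E i x) = (\<Sum>i\<in>UNIV. \<theta> i x (\<Gamma> x v w) *\<^sub>R E i x)"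
    by simp
  then show "z = \<Gamma> x v w"
    by (simp only: frame_expand[OF x, symmetric])
qed (simp add: koszul[OF x])

section \<open>Curvature from the structure equations of the frame\<close>

lemma curvature_eq:
  assumes x: "x \<in> U"
  shows "curvature h x u v w =
     frechet_derivative (\<lambda>y. \<Gamma> y v w) (at x) u - frechet_derivative (\<lambda>y. \<Gamma> y u w) (at x) v
     + \<Gamma> x u (\<Gamma> x v w) - \<Gamma> x v (\<Gamma> x u w)"
proof -
  have "frechet_derivative (\<lambda>y. christoffel h y v w) (at x) = frechet_derivative (\<lambda>y. \<Gamma> y v w) (at x)" for v w
    by (rule frechet_derivative_transform_within_open[OF diff_\<Gamma>[OF x] open_U x, symmetric])
      (simp add: christoffel_eq)
  then show ?thesis by (simp add: curvature_def christoffel_eq x)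
qed

text \<open>The Maurer-Cartan equation. Since \<theta> is constant on the frame, its derivative
  comes from \<open>dE\<close> alone, and the antisymmetric part of \<open>dE\<close> is the
  bracket.\<close>

lemma d\<theta>_E:
  assumes x: "x \<in> U"
  shows "frechet_derivative (\<lambda>y. \<theta> i y (E k x)) (at x) (E j x)
    - frechet_derivative (\<lambda>y. \<theta> i y (E j x)) (at x) (E k x) = - c j k i"
proof -
  \<comment> \<open>A dummy real factor, set to 1 below, makes the linear form bilinear, so that the
    product rule for bilinear maps applies.\<close>
  have bil: "bilinear (\<lambda>(r::real) v. r * \<theta> i y v)" if "y \<in> U" for y
    using linear_\<theta>[OF that] by (simp add: bilinear_def linear_iff algebra_simps)
  have d: "frechet_derivative (\<lambda>y. \<theta> i y (E k x)) (at x) u = - \<theta> i x (dE k x u)" for k u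
  proof -
    have "((\<lambda>y. 1 * \<theta> i y (E k y)) has_derivative (\<lambda>u. 0)) (at x)"
      by (rule has_derivative_transform_within_open[OF has_derivative_const open_U x]) (simp add: \<theta>_E)
    moreover have "((\<lambda>y. 1 * \<theta> i y (E k y)) has_derivative (\<lambda>u. frechet_derivative (\<lambda>y. 1 * \<theta> i y (E k x)) (at x) u
        + 0 * \<theta> i x (E k x) + 1 * \<theta> i x (dE k x u))) (at x)"
      by (rule has_derivative_bilinear_field[OF open_U x bil _ has_derivative_const has_derivative_E[OF x]])
        (simp_all add: diff_\<theta> x)
    ultimately have "(\<lambda>u. 0) = (\<lambda>u. frechet_derivative (\<lambda>y. 1 * \<theta> i y (E k x)) (at x) u
        + 0 * \<theta> i x (E k x) + 1 * \<theta> i x (dE k x u))"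
      by (rule has_derivative_unique)
    from fun_cong[OF this, of u] show ?thesis by simp
  qed
  have "\<theta> i x (dE k x (E j x)) - \<theta> i x (dE j x (E k x)) = \<theta> i x (\<Sum>l\<in>UNIV. c j k l *\<^sub>R E l x)"
    by (simp add: linear_diff[OF linear_\<theta>[OF x]] flip: bracket[OF x])
  also have "\<dots> = c j k i"
    by (simp add: linear_sum[OF linear_\<theta>[OF x]] linear_cmul[OF linear_\<theta>[OF x]] \<theta>_E x
        if_distrib[of "\<lambda>x. _ * x"] cong: if_cong)
  finally show ?thesis by (simp add: d)
qed

lemma d2E_symmetric:
  assumes x: "x \<in> U"
  shows "frechet_derivative (\<lambda>y. dE k y v) (at x) u = frechet_derivative (\<lambda>y. dE k y u) (at x) v"
proof (rule euclidean_eqI)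
  fix b :: 'e
  have d: "((\<lambda>y. dE k y w \<bullet> b) has_derivative (\<lambda>z. frechet_derivative (\<lambda>y. dE k y w) (at x) z \<bullet> b)) (at x)" for w
    using diff2_E[OF x, of k w] by (intro has_derivative_inner_left) (simp flip: frechet_derivative_works)
  show "frechet_derivative (\<lambda>y. dE k y v) (at x) u \<bullet> b = frechet_derivative (\<lambda>y. dE k y u) (at x) v \<bullet> b"
    using second_derivative_symmetric[where f = "\<lambda>y. E k y \<bullet> b" and f' = "\<lambda>y w. dE k y w \<bullet> b",
        OF open_U x has_derivative_inner_left[OF has_derivative_E] d d] .
qed

text \<open>The field \<open>\<Gamma> y v (E k y)\<close> is differentiated by the product rule and
  through its closed form \<open>\<Gamma>_E\<close>. Comparison isolates the derivative with
  \<open>E k\<close> frozen at \<open>x\<close>, which is the one that occurs in the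
  curvature.\<close>

lemma d\<Gamma>_E:
  assumes x: "x \<in> U"
  shows "frechet_derivative (\<lambda>y. \<Gamma> y v (E k x)) (at x) u =
    (\<Sum>l\<in>UNIV. frechet_derivative (\<lambda>y. \<omega> k l y v) (at x) u *\<^sub>R E l x + \<omega> k l x v *\<^sub>R dE l x u)
    - frechet_derivative (\<lambda>y. dE k y v) (at x) u - \<Gamma> x v (dE k x u)"
proof -
  have 1: "((\<lambda>y. \<Gamma> y v (E k y)) has_derivative (\<lambda>u. frechet_derivative (\<lambda>y. \<Gamma> y v (E k x)) (at x) u
      + \<Gamma> x 0 (E k x) + \<Gamma> x v (dE k x u))) (at x)"
    by (rule has_derivative_bilinear_field[OF open_U x bilinear_\<Gamma> diff_\<Gamma>[OF x] has_derivative_const has_derivative_E[OF x]])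
  have \<omega>: "((\<lambda>y. \<omega> k l y v) has_derivative frechet_derivative (\<lambda>y. \<omega> k l y v) (at x)) (at x)" for l
    using diff_\<omega>[OF x] by (simp flip: frechet_derivative_works)
  have d2: "((\<lambda>y. dE k y v) has_derivative frechet_derivative (\<lambda>y. dE k y v) (at x)) (at x)"
    using diff2_E[OF x] by (simp flip: frechet_derivative_works)
  have 2: "((\<lambda>y. \<Gamma> y v (E k y)) has_derivative (\<lambda>u. (\<Sum>l\<in>UNIV. \<omega> k l x v *\<^sub>R dE l x u
      + frechet_derivative (\<lambda>y. \<omega> k l y v) (at x) u *\<^sub>R E l x) - frechet_derivative (\<lambda>y. dE k y v) (at x) u)) (at x)"
  proof (rule has_derivative_transform_within_open[OF _ open_U x])
    show "((\<lambda>y. (\<Sum>l\<in>UNIV. \<omega> k l y v *\<^sub>R E l y) - dE k y v) has_derivative (\<lambda>u. (\<Sum>l\<in>UNIV. \<omega> k l x v *\<^sub>R dE l x u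
      + frechet_derivative (\<lambda>y. \<omega> k l y v) (at x) u *\<^sub>R E l x) - frechet_derivative (\<lambda>y. dE k y v) (at x) u)) (at x)"
      by (intro has_derivative_diff has_derivative_sum has_derivative_scaleR \<omega> d2 has_derivative_E x)
  qed (simp add: \<Gamma>_E)
  have "\<Gamma> x 0 (E k x) = 0" by (rule bilinear_lzero[OF bilinear_\<Gamma>[OF x]])
  then show ?thesis
    using fun_cong[OF has_derivative_unique[OF 1 2], of u] by (simp add: eq_diff_eq add.commute)
qed

text \<open>Cartan's second structure equation. Antisymmetrizing removes the second derivatives of
  \<open>E k\<close>; the terms with first derivatives of the frame cancel between the derivatives
  of \<Gamma> and the products of two \<Gamma>.\<close>

lemma curvature_E:
  assumes x: "x \<in> U"
  shows "curvature h x u v (E k x) =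
    (\<Sum>l\<in>UNIV. (frechet_derivative (\<lambda>y. \<omega> k l y v) (at x) u - frechet_derivative (\<lambda>y. \<omega> k l y u) (at x) v) *\<^sub>R E l x)
    + (\<Sum>l\<in>UNIV. \<Sum>m\<in>UNIV. (\<omega> k l x v * \<omega> l m x u - \<omega> k l x u * \<omega> l m x v) *\<^sub>R E m x)"
proof -
  note bil = bilinear_\<Gamma>[OF x]
  have lin: "linear (\<Gamma> x u)" for u using bil by (simp add: bilinear_def)
  have \<Gamma>\<Gamma>: "\<Gamma> x u (\<Gamma> x v (E k x)) = (\<Sum>l\<in>UNIV. \<omega> k l x v *\<^sub>R ((\<Sum>m\<in>UNIV. \<omega> l m x u *\<^sub>R E m x) - dE l x u))
      - \<Gamma> x u (dE k x v)" for u v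
    unfolding \<Gamma>_E[OF x] linear_diff[OF lin] linear_sum[OF lin] linear_cmul[OF lin] ..
  show ?thesis
    unfolding curvature_eq[OF x] d\<Gamma>_E[OF x] \<Gamma>\<Gamma> d2E_symmetric[OF x, of k v u]
    by (simp add: sum.distrib sum_subtractf scaleR_diff_left scaleR_diff_right scaleR_right.sum)
qed

text \<open>With constant \<gamma>, each \<omega> is a constant combination of the \<theta> and
  inherits their Maurer-Cartan equation.\<close>

lemma d\<omega>_E:
  assumes x: "x \<in> U"
  shows "frechet_derivative (\<lambda>y. \<omega> k l y (E j x)) (at x) (E i x)
    - frechet_derivative (\<lambda>y. \<omega> k l y (E i x)) (at x) (E j x) = - (\<Sum>m\<in>UNIV. c i j m * \<gamma> m k l)"
proof -
  have "frechet_derivative (\<lambda>y. \<omega> k l y v) (at x) u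
      = (\<Sum>m\<in>UNIV. frechet_derivative (\<lambda>y. \<theta> m y v) (at x) u * \<gamma> m k l)" for u v
  proof -
    have "((\<lambda>y. \<theta> m y v) has_derivative frechet_derivative (\<lambda>y. \<theta> m y v) (at x)) (at x)" for m
      using diff_\<theta>[OF x] by (simp flip: frechet_derivative_works)
    then have "((\<lambda>y. \<omega> k l y v) has_derivative
        (\<lambda>u. \<Sum>m\<in>UNIV. frechet_derivative (\<lambda>y. \<theta> m y v) (at x) u * \<gamma> m k l)) (at x)"
      unfolding \<omega>_def by (intro has_derivative_sum has_derivative_mult_left)
    from fun_cong[OF frechet_derivative_at[OF this], of u] show ?thesis by simp
  qed
  then show ?thesis
    by (simp add: d\<theta>_E[OF x] sum_negf flip: sum_subtractf left_diff_distrib)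
qed

lemma curvature_E_E:
  assumes x: "x \<in> U"
  shows "curvature h x (E i x) (E j x) (E k x) = (\<Sum>m\<in>UNIV.
    (\<Sum>l\<in>UNIV. \<gamma> j k l * \<gamma> i l m - \<gamma> i k l * \<gamma> j l m - c i j l * \<gamma> l k m) *\<^sub>R E m x)"
proof -
  have "(\<Sum>l\<in>UNIV. \<Sum>m\<in>UNIV. (\<gamma> j k l * \<gamma> i l m - \<gamma> i k l * \<gamma> j l m) *\<^sub>R E m x)
      = (\<Sum>m\<in>UNIV. (\<Sum>l\<in>UNIV. \<gamma> j k l * \<gamma> i l m - \<gamma> i k l * \<gamma> j l m) *\<^sub>R E m x)"
    by (subst sum.swap) (simp only: scaleR_left.sum)
  then show ?thesis
    unfolding curvature_E[OF x] d\<omega>_E[OF x] \<omega>_E[OF x]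
    by (simp add: sum.distrib sum_subtractf scaleR_diff_left sum_negf)
qed

text \<open>This allows the trace, defined with \<open>Basis\<close>, to be taken in the frame
  instead.\<close>

lemma linear_curvature:
  assumes x: "x \<in> U"
  shows "linear (\<lambda>u. curvature h x u v w)"
proof -
  have bil: "bilinear (\<lambda>v w. frechet_derivative (\<lambda>y. \<Gamma> y v w) (at x) u)" for u
    by (rule bilinear_frechet_derivative[OF open_U x bilinear_\<Gamma> diff_\<Gamma>[OF x]])
  have "linear (frechet_derivative (\<lambda>y. \<Gamma> y v w) (at x))" for v w
    by (rule linear_frechet_derivative[OF diff_\<Gamma>[OF x]])
  note lin = this[THEN linear_add] this[THEN linear_cmul] bilinear_ladd[OF bil] bilinear_lmul[OF bil]
    bilinear_ladd[OF bilinear_\<Gamma>[OF x]] bilinear_radd[OF bilinear_\<Gamma>[OF x]]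
    bilinear_lmul[OF bilinear_\<Gamma>[OF x]] bilinear_rmul[OF bilinear_\<Gamma>[OF x]]
  show ?thesis
    by (simp add: curvature_eq[OF x] linear_iff lin algebra_simps)
qed

lemma ricci_E:
  assumes x: "x \<in> U"
  shows "ricci_in_coords h x (E j x) (E k x) = frame_ricci G H c j k"
proof -
  let ?R = "\<lambda>u. curvature h x u (E j x) (E k x)"
  have R: "?R b = (\<Sum>a\<in>UNIV. \<theta> a x b *\<^sub>R ?R (E a x))" for b
    using arg_cong[OF frame_expand[OF x, of b], of ?R]
    by (simp only: linear_sum[OF linear_curvature[OF x]] linear_cmul[OF linear_curvature[OF x]])
  have "?R b \<bullet> b = (\<Sum>a\<in>UNIV. \<theta> a x b * (?R (E a x) \<bullet> b))" for b
    by (subst R) (simp add: inner_sum_left)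
  then have "ricci_in_coords h x (E j x) (E k x)
      = (\<Sum>b\<in>Basis. \<Sum>a\<in>UNIV. \<theta> a x b * (?R (E a x) \<bullet> b))"
    by (simp add: ricci_in_coords_def)
  also have "\<dots> = (\<Sum>a\<in>UNIV. \<theta> a x (\<Sum>b\<in>Basis. (?R (E a x) \<bullet> b) *\<^sub>R b))"
    by (subst sum.swap) (simp add: linear_sum[OF linear_\<theta>[OF x]] linear_cmul[OF linear_\<theta>[OF x]] mult.commute)
  also have "\<dots> = (\<Sum>a\<in>UNIV. \<theta> a x (?R (E a x)))"
    by (simp only: euclidean_representation)
  also have "\<dots> = frame_ricci G H c j k"
    unfolding curvature_E_E[OF x] frame_ricci_def
    by (simp add: linear_sum[OF linear_\<theta>[OF x]] linear_cmul[OF linear_\<theta>[OF x]] \<theta>_E x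
        if_distrib[of "\<lambda>x. _ * x"] cong: if_cong)
  finally show ?thesis .
qed

end

section \<open>Invariant frames on manifolds\<close>

lemma smooth_on_differentiable:
  assumes "smooth_on S f" "open S" "x \<in> S"
  shows "f differentiable (at x)"
    and "(\<lambda>y. frechet_derivative f (at y) v) differentiable (at x)"
proof -
  have "C_on (Suc (Suc 0)) S f" using assms unfolding smooth_on_def by blast
  then show "f differentiable (at x)" "(\<lambda>y. frechet_derivative f (at y) v) differentiable (at x)"
    using assms by (simp_all add: differentiable_on_eq_differentiable_at)
qed

lemma C_on_cong:
  assumes "open S" "C_on k S f" "\<And>x. x \<in> S \<Longrightarrow> f x = g x"
  shows "C_on k S g"
  using assms(2,3)
proof (induction k arbitrary: f g)
  case 0
  then show ?case using continuous_on_cong[of S S f g] by simp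
next
  case (Suc k)
  have f: "f differentiable (at x)" if "x \<in> S" for x
    using Suc.prems(1) that assms(1) by (simp add: differentiable_on_eq_differentiable_at)
  have eq: "frechet_derivative f (at x) = frechet_derivative g (at x)" if "x \<in> S" for x
    by (rule frechet_derivative_transform_within_open[OF f assms(1)]) (use that Suc.prems in auto)
  have "C_on k S (\<lambda>x. frechet_derivative g (at x) v)" for v
    by (rule Suc.IH[of "\<lambda>x. frechet_derivative f (at x) v"]) (use Suc.prems(1) eq in auto)
  moreover have "g differentiable (at x)" if "x \<in> S" for x
    using f[OF that] has_derivative_transform_within_open[OF _ assms(1) that] Suc.prems(2)
    unfolding differentiable_def by blast
  then have "g differentiable_on S"
    using assms(1) by (simp add: differentiable_on_eq_differentiable_at)
  ultimately show ?case by simp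
qed

text \<open>Serves the field \<open>Y 4\<close>, a combination of the \<open>X i\<close>. The
  formula for the derivative holds on \<open>S\<close> only, hence the passage through
  \<open>C_on_cong\<close>.\<close>

lemma C_on_add_scaleR:
  assumes "open S" "C_on k S f" "C_on k S g"
  shows "C_on k S (\<lambda>x. r *\<^sub>R f x + g x)"
  using assms(2,3)
proof (induction k arbitrary: f g)
  case 0
  then show ?case by (auto intro!: continuous_intros)
next
  case (Suc k)
  have fg: "f differentiable (at x)" "g differentiable (at x)" if "x \<in> S" for x
    using Suc.prems that assms(1) by (simp_all add: differentiable_on_eq_differentiable_at)
  have eq: "frechet_derivative (\<lambda>x. r *\<^sub>R f x + g x) (at x) v
      = r *\<^sub>R frechet_derivative f (at x) v + frechet_derivative g (at x) v" if "x \<in> S" for x v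
  proof -
    have "((\<lambda>x. r *\<^sub>R f x + g x) has_derivative
        (\<lambda>v. r *\<^sub>R frechet_derivative f (at x) v + frechet_derivative g (at x) v)) (at x)"
      using fg[OF that] by (intro has_derivative_add has_derivative_scaleR_right) (simp_all flip: frechet_derivative_works)
    from fun_cong[OF frechet_derivative_at[OF this], of v] show ?thesis by simp
  qed
  have "C_on k S (\<lambda>x. frechet_derivative f (at x) v)" "C_on k S (\<lambda>x. frechet_derivative g (at x) v)" for v
    using Suc.prems by simp_all
  then have "C_on k S (\<lambda>x. frechet_derivative (\<lambda>x. r *\<^sub>R f x + g x) (at x) v)" for v
    by (rule C_on_cong[OF assms(1) Suc.IH eq[symmetric]])
  moreover have "(\<lambda>x. r *\<^sub>R f x + g x) differentiable_on S"
    using fg assms(1) by (simp add: differentiable_on_eq_differentiable_at)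
  ultimately show ?case by simp
qed

section \<open>Tangent vectors, brackets and metrics in charts\<close>

locale smooth_manifold =
  fixes A :: "('g::topological_space, 'e::euclidean_space) chart set"
  assumes smooth_atlas: "smooth_atlas A"
begin

lemma is_chart: "c \<in> A \<Longrightarrow> is_chart c"
  using smooth_atlas by (auto simp: smooth_atlas_def)

lemma open_chart_image: "c \<in> A \<Longrightarrow> open (chart_image c)"
  using is_chart by (auto simp: is_chart_def)

lemma chart_inv_chart [simp]: "c \<in> A \<Longrightarrow> p \<in> fst c \<Longrightarrow> chart_inv c (snd c p) = p"
  using is_chart[of c] by (auto simp: is_chart_def homeomorphism_def)

lemma chart_inv_in: "c \<in> A \<Longrightarrow> x \<in> chart_image c \<Longrightarrow> chart_inv c x \<in> fst c"
  by auto

lemma chart_chart_inv: "c \<in> A \<Longrightarrow> x \<in> chart_image c \<Longrightarrow> snd c (chart_inv c x) = x"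
  by auto

lemma chart_at: "chart_at A p \<in> charts_at A p"
proof -
  have "p \<in> (\<Union>c\<in>A. fst c)" using smooth_atlas by (simp add: smooth_atlas_def)
  then have "\<exists>c. c \<in> charts_at A p" by (auto simp: charts_at_def)
  then show ?thesis unfolding chart_at_def by (rule someI_ex)
qed

lemma open_chart_overlap:
  assumes "c \<in> A" "d \<in> A"
  shows "open (snd c ` (fst c \<inter> fst d))"
proof -
  have hom: "homeomorphism (fst c) (chart_image c) (snd c) (chart_inv c)" and o: "open (fst c)" "open (fst d)"
    using is_chart assms by (auto simp: is_chart_def)
  have "openin (top_of_set (fst c)) (fst c \<inter> fst d)"
    using o by (simp add: openin_open_Int)
  then have "openin (top_of_set (chart_image c)) (snd c ` (fst c \<inter> fst d))"
    using homeomorphism_imp_open_map[OF hom] by blast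
  then show ?thesis
    using open_chart_image[OF assms(1)] openin_open_trans by blast
qed

lemma transition_differentiable:
  assumes "c \<in> charts_at A p" "d \<in> charts_at A p"
  shows "(snd d \<circ> chart_inv c) differentiable (at (snd c p))"
proof (rule smooth_on_differentiable(1))
  show "smooth_on (snd c ` (fst c \<inter> fst d)) (snd d \<circ> chart_inv c)"
    using smooth_atlas assms by (auto simp: smooth_atlas_def charts_at_def)
qed (use assms open_chart_overlap in \<open>auto simp: charts_at_def\<close>)

lemma linear_transition:
  assumes "c \<in> charts_at A p" "d \<in> charts_at A p"
  shows "linear (frechet_derivative (snd d \<circ> chart_inv c) (at (snd c p)))"
  by (rule linear_frechet_derivative[OF transition_differentiable[OF assms]])

lemma tangent_of_coords_add:
  assumes "c \<in> charts_at A p"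
  shows "tangent_of_coords A c p (u + v) = (\<lambda>d. tangent_of_coords A c p u d + tangent_of_coords A c p v d)"
  using linear_add[OF linear_transition[OF assms]] by (auto simp: tangent_of_coords_def)

lemma tangent_of_coords_scaleR:
  assumes "c \<in> charts_at A p"
  shows "tangent_of_coords A c p (r *\<^sub>R u) = (\<lambda>d. r *\<^sub>R tangent_of_coords A c p u d)"
  using linear_cmul[OF linear_transition[OF assms]] by (auto simp: tangent_of_coords_def)

text \<open>Compatibility between two further charts is the chain rule for coordinate changes
  starting in \<open>c\<close>.\<close>

lemma tangent_of_coords_in:
  assumes c: "c \<in> charts_at A p"
  shows "tangent_of_coords A c p u \<in> tangent_space A p"
proof -
  have chain: "frechet_derivative (snd d' \<circ> chart_inv c) (at (snd c p)) u
      = frechet_derivative (snd d' \<circ> chart_inv d) (at (snd d p)) (frechet_derivative (snd d \<circ> chart_inv c) (at (snd c p)) u)"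
    if d: "d \<in> charts_at A p" "d' \<in> charts_at A p" for d d'
  proof -
    have p: "snd d p = (snd d \<circ> chart_inv c) (snd c p)"
      using c by (simp add: charts_at_def)
    have t: "(snd d' \<circ> chart_inv d) differentiable (at ((snd d \<circ> chart_inv c) (snd c p)))"
      using transition_differentiable[OF d] p by simp
    have "frechet_derivative (snd d' \<circ> chart_inv c) (at (snd c p))
      = frechet_derivative ((snd d' \<circ> chart_inv d) \<circ> (snd d \<circ> chart_inv c)) (at (snd c p))"
    proof (rule frechet_derivative_transform_within_open[OF transition_differentiable[OF c d(2)]])
      show "open (snd c ` (fst c \<inter> fst d))" "snd c p \<in> snd c ` (fst c \<inter> fst d)"
        using c d open_chart_overlap by (auto simp: charts_at_def)
    qed (use c d in \<open>auto simp: charts_at_def\<close>)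
    also have "\<dots> = frechet_derivative (snd d' \<circ> chart_inv d) (at (snd d p))
        \<circ> frechet_derivative (snd d \<circ> chart_inv c) (at (snd c p))"
      by (subst p) (rule frechet_derivative_compose[OF transition_differentiable[OF c d(1)] t])
    finally show ?thesis by simp
  qed
  show ?thesis
    unfolding tangent_space_def
  proof (intro CollectI conjI allI impI ballI)
    show "tangent_of_coords A c p u d = 0" if "d \<notin> charts_at A p" for d
      using that by (simp add: tangent_of_coords_def)
    show "tangent_of_coords A c p u d'
        = frechet_derivative (snd d' \<circ> chart_inv d) (at (snd d p)) (tangent_of_coords A c p u d)"
      if "d \<in> charts_at A p" "d' \<in> charts_at A p" for d d'
      by (simp only: tangent_of_coords_def that if_True) (rule chain[OF that])
  qed
qed

lemma tangent_of_coords_self: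
  assumes "c \<in> charts_at A p" "v \<in> tangent_space A p"
  shows "tangent_of_coords A c p (v c) = v"
proof
  fix d
  have "d \<in> charts_at A p \<Longrightarrow> v d = frechet_derivative (snd d \<circ> chart_inv c) (at (snd c p)) (v c)"
    and "d \<notin> charts_at A p \<Longrightarrow> v d = 0"
    using assms unfolding tangent_space_def by blast+
  then show "tangent_of_coords A c p (v c) d = v d"
    by (cases "d \<in> charts_at A p") (simp_all only: tangent_of_coords_def if_True if_False not_False_eq_True simp_thms)
qed

lemma tangent_space_add_scaleR:
  assumes "u \<in> tangent_space A p" "v \<in> tangent_space A p"
  shows "(\<lambda>c. r *\<^sub>R u c + v c) \<in> tangent_space A p"
proof -
  have c: "chart_at A p \<in> charts_at A p" by (rule chart_at)
  have "tangent_of_coords A (chart_at A p) p (r *\<^sub>R u (chart_at A p) + v (chart_at A p)) = (\<lambda>c. r *\<^sub>R u c + v c)"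
    using tangent_of_coords_self[OF c] assms
    by (simp add: tangent_of_coords_add[OF c] tangent_of_coords_scaleR[OF c])
  then show ?thesis using tangent_of_coords_in[OF c] by metis
qed

lemma smooth_vector_field_add_scaleR:
  assumes "smooth_vector_field A X" "smooth_vector_field A Y"
  shows "smooth_vector_field A (\<lambda>p c. r *\<^sub>R X p c + Y p c)"
  unfolding smooth_vector_field_def smooth_on_def
proof (intro conjI allI ballI)
  show "(\<lambda>c. r *\<^sub>R X p c + Y p c) \<in> tangent_space A p" for p
    using assms by (intro tangent_space_add_scaleR) (auto simp: smooth_vector_field_def)
  show "C_on k (chart_image c) (\<lambda>x. r *\<^sub>R X (chart_inv c x) c + Y (chart_inv c x) c)" if "c \<in> A" for c k
    using assms that unfolding smooth_vector_field_def smooth_on_def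
    by (intro C_on_add_scaleR[OF open_chart_image]) blast+
qed

lemma lie_bracket_add_scaleR_right:
  assumes X: "smooth_vector_field A X" and Y: "smooth_vector_field A Y" and Z: "smooth_vector_field A Z"
  shows "lie_bracket A Z (\<lambda>p c. r *\<^sub>R X p c + Y p c)
    = (\<lambda>p c. r *\<^sub>R lie_bracket A Z X p c + lie_bracket A Z Y p c)"
proof (intro ext)
  fix p and c :: "('g, 'e) chart"
  show "lie_bracket A Z (\<lambda>p c. r *\<^sub>R X p c + Y p c) p c
    = r *\<^sub>R lie_bracket A Z X p c + lie_bracket A Z Y p c"
  proof (cases "c \<in> charts_at A p")
    case c: True
    have diff: "(\<lambda>x. W (chart_inv c x) c) differentiable (at (snd c p))" if "smooth_vector_field A W" for W
      by (rule smooth_on_differentiable(1)[of "chart_image c"])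
        (use that c open_chart_image in \<open>auto simp: smooth_vector_field_def charts_at_def\<close>)
    have "((\<lambda>x. r *\<^sub>R X (chart_inv c x) c + Y (chart_inv c x) c) has_derivative
        (\<lambda>v. r *\<^sub>R frechet_derivative (\<lambda>x. X (chart_inv c x) c) (at (snd c p)) v
          + frechet_derivative (\<lambda>x. Y (chart_inv c x) c) (at (snd c p)) v)) (at (snd c p))"
      using diff[OF X] diff[OF Y]
      by (intro has_derivative_add has_derivative_scaleR_right) (simp_all flip: frechet_derivative_works)
    note fun_cong[OF frechet_derivative_at[OF this]]
    moreover have "linear (frechet_derivative (\<lambda>x. Z (chart_inv c x) c) (at (snd c p)))"
      by (rule linear_frechet_derivative[OF diff[OF Z]])
    ultimately show ?thesis
      using c by (simp add: lie_bracket_def linear_add linear_cmul algebra_simps)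
  qed (simp add: lie_bracket_def)
qed

lemma lie_bracket_antisymmetric: "lie_bracket A X Y p c = - lie_bracket A Y X p c"
  by (simp add: lie_bracket_def)

lemma metric_in_chart_bilinear:
  assumes g: "riemannian_metric A g" and c: "c \<in> A" and x: "x \<in> chart_image c"
  shows "bilinear (metric_in_chart A g c x)" "metric_in_chart A g c x u v = metric_in_chart A g c x v u"
proof -
  define p where "p = chart_inv c x"
  have cp: "c \<in> charts_at A p" using c chart_inv_in[OF c x] by (simp add: charts_at_def p_def)
  have sym: "g p u v = g p v u" and scale: "g p (\<lambda>c. r *\<^sub>R u c) v = r * g p u v"
    and add: "w \<in> tangent_space A p \<Longrightarrow> g p (\<lambda>c. u c + v c) w = g p u w + g p v w"
    if "u \<in> tangent_space A p" "v \<in> tangent_space A p" for u v w r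
    using g that unfolding riemannian_metric_def by blast+
  note toc = tangent_of_coords_in[OF cp]
  have eq: "metric_in_chart A g c x u v = g p (tangent_of_coords A c p u) (tangent_of_coords A c p v)" for u v
    by (simp add: metric_in_chart_def Let_def p_def)
  show s: "metric_in_chart A g c x u v = metric_in_chart A g c x v u" for u v
    unfolding eq using sym toc by blast
  have "linear (\<lambda>u. metric_in_chart A g c x u v)" for v
    by (simp add: linear_iff eq tangent_of_coords_add[OF cp] tangent_of_coords_scaleR[OF cp] add scale toc)
  then show "bilinear (metric_in_chart A g c x)"
    unfolding bilinear_def using s[abs_def] by metis
qed

end

text \<open>The index type \<open>'n\<close> is also that of the model space, so there are as many
  fields as dimensions and the spanning condition in charts follows by counting.\<close>

locale invariant_frame = smooth_manifold A
  for A :: "('g::topological_space, real ^ 'n::finite) chart set" +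
  fixes Y :: "'n \<Rightarrow> ('g, real ^ 'n) vector_field" and C :: "'n \<Rightarrow> 'n \<Rightarrow> 'n \<Rightarrow> real"
  assumes smooth: "\<And>i. smooth_vector_field A (Y i)"
    and bracket: "\<And>i j p c. lie_bracket A (Y i) (Y j) p c = (\<Sum>k\<in>UNIV. C i j k *\<^sub>R Y k p c)"
begin

lemma homogeneous_frame_chart:
  assumes g: "riemannian_metric A g" and gram: "\<And>p i j. g p (Y i p) (Y j p) = G i j"
    and inv: "\<And>i j. (\<Sum>m\<in>UNIV. H i m * G m j) = (if i = j then 1 else 0)"
      "\<And>i j. (\<Sum>m\<in>UNIV. G i m * H m j) = (if i = j then 1 else 0)"
    and c: "c \<in> A"
  shows "homogeneous_frame (chart_image c) (metric_in_chart A g c) (\<lambda>i x. Y i (chart_inv c x) c) G H C"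
proof
  show "open (chart_image c)" by (rule open_chart_image[OF c])
  fix x assume x: "x \<in> chart_image c"
  define p where "p = chart_inv c x"
  have cp: "c \<in> charts_at A p" using c chart_inv_in[OF c x] by (simp add: charts_at_def p_def)
  have xp: "snd c p = x" using chart_chart_inv[OF c x] by (simp add: p_def)
  show bil: "bilinear (metric_in_chart A g c x)"
    and "metric_in_chart A g c x u v = metric_in_chart A g c x v u" for u v
    using metric_in_chart_bilinear[OF g c x] by auto
  show "(\<lambda>y. metric_in_chart A g c y u v) differentiable at x" for u v
    using g c by (intro smooth_on_differentiable(1)[OF _ open_chart_image[OF c] x])
      (auto simp: riemannian_metric_def)
  have sm: "smooth_on (chart_image c) (\<lambda>x. Y i (chart_inv c x) c)" for i
    using smooth c unfolding smooth_vector_field_def by blast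
  show "(\<lambda>x. Y i (chart_inv c x) c) differentiable at x"
    and "(\<lambda>y. frechet_derivative (\<lambda>x. Y i (chart_inv c x) c) (at y) v) differentiable at x" for i v
    by (rule smooth_on_differentiable[OF sm open_chart_image[OF c] x])+
  have Y: "Y i p \<in> tangent_space A p" for i
    using smooth by (auto simp: smooth_vector_field_def)
  show gr: "metric_in_chart A g c x (Y i (chart_inv c x) c) (Y j (chart_inv c x) c) = G i j" for i j
    using gram by (simp add: metric_in_chart_def Let_def tangent_of_coords_self[OF cp Y] flip: p_def)
  show "frechet_derivative (\<lambda>x. Y j (chart_inv c x) c) (at x) (Y i (chart_inv c x) c)
      - frechet_derivative (\<lambda>x. Y i (chart_inv c x) c) (at x) (Y j (chart_inv c x) c)
      = (\<Sum>k\<in>UNIV. C i j k *\<^sub>R Y k (chart_inv c x) c)" for i j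
    using bracket[of i j p c] cp xp by (simp add: lie_bracket_def flip: p_def)
  let ?f = "\<lambda>r :: real ^ 'n. \<Sum>i\<in>UNIV. (r $ i) *\<^sub>R Y i (chart_inv c x) c"
  have lin: "linear ?f"
    by (simp add: linear_iff sum.distrib scaleR_add_left scaleR_right.sum)
  \<comment> \<open>A relation among the frame vectors, paired with each of them, is a kernel vector
    of the invertible Gram matrix. Injectivity gives surjectivity because both sides are
    \<open>real ^ 'n\<close>.\<close>
  have "inj ?f"
  proof (rule linear_inj_on_iff_eq_0[THEN iffD2, OF lin subspace_UNIV], intro ballI impI)
    fix r assume "?f r = 0"
    then have "0 = metric_in_chart A g c x (?f r) (Y j (chart_inv c x) c)" for j
      using bilinear_lzero[OF bil] by simp
    also have "metric_in_chart A g c x (?f r) (Y j (chart_inv c x) c) = (\<Sum>i\<in>UNIV. r $ i * G i j)" for j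
    proof -
      have l: "linear (\<lambda>u. metric_in_chart A g c x u (Y j (chart_inv c x) c))"
        using bil by (simp add: bilinear_def)
      show ?thesis by (simp add: linear_sum[OF l] linear_cmul[OF l] gr)
    qed
    finally have 0: "(\<Sum>i\<in>UNIV. r $ i * G i j) = 0" for j by simp
    have "r $ k = 0" for k
    proof -
      have "r $ k = (\<Sum>i\<in>UNIV. r $ i * (\<Sum>j\<in>UNIV. G i j * H j k))"
        by (simp add: inv if_distrib[of "\<lambda>x. _ * x"] cong: if_cong)
      also have "\<dots> = (\<Sum>j\<in>UNIV. (\<Sum>i\<in>UNIV. r $ i * G i j) * H j k)"
        by (simp add: sum_distrib_left sum_distrib_right mult.assoc) (rule sum.swap)
      finally show ?thesis by (simp add: 0)
    qed
    then show "r = 0" by (simp add: vec_eq_iff)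
  qed
  then have "surj ?f" using linear_injective_imp_surjective[OF lin] by blast
  then have "v \<in> span (range (\<lambda>i. Y i (chart_inv c x) c))" for v
  proof -
    from surjD[OF \<open>surj ?f\<close>, of v] obtain r where v: "v = ?f r" ..
    show ?thesis unfolding v by (intro span_sum span_scale span_base rangeI)
  qed
  then show "span (range (\<lambda>i. Y i (chart_inv c x) c)) = UNIV" by blast
qed (use inv in auto)

lemma ricci_frame:
  assumes "riemannian_metric A g" and "\<And>p i j. g p (Y i p) (Y j p) = G i j"
    and "\<And>i j. (\<Sum>m\<in>UNIV. H i m * G m j) = (if i = j then 1 else 0)"
      "\<And>i j. (\<Sum>m\<in>UNIV. G i m * H m j) = (if i = j then 1 else 0)"
  shows "ricci A g p (Y i p) (Y j p) = frame_ricci G H C i j"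
proof -
  define c where "c = chart_at A p"
  have c: "c \<in> A" "p \<in> fst c" using chart_at[of p] by (auto simp: c_def charts_at_def)
  interpret homogeneous_frame "chart_image c" "metric_in_chart A g c" "\<lambda>i x. Y i (chart_inv c x) c" G H C
    by (rule homogeneous_frame_chart[OF assms c(1)])
  show ?thesis
    using ricci_E[of "snd c p" i j] c by (simp add: ricci_def Let_def flip: c_def)
qed

end

section \<open>Structure constants of the frame \<open>Y\<close>\<close>

text \<open>The coefficient of \<open>Y\<^sub>k\<close> in \<open>[Y\<^sub>i, Y\<^sub>j]\<close>, given for one order of each pair \<open>i, j\<close> and \<open>0\<close> for the other.\<close>

definition half_bracket :: "real \<Rightarrow> real \<Rightarrow> real \<Rightarrow> 4 \<Rightarrow> 4 \<Rightarrow> 4 \<Rightarrow> real" where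
  "half_bracket a1 a2 a3 i j k =
    (if (i, j, k) = (1, 2, 3) then - 1 else
     if (i, j, k) = (2, 3, 1) then 1 else
     if (i, j, k) = (3, 1, 2) then 1 else
     if (i, j, k) = (1, 4, 2) then - a3 else
     if (i, j, k) = (1, 4, 3) then - a2 else
     if (i, j, k) = (2, 4, 1) then a3 else
     if (i, j, k) = (2, 4, 3) then a1 else
     if (i, j, k) = (3, 4, 1) then - a2 else
     if (i, j, k) = (3, 4, 2) then a1 else 0)"

definition Y_bracket :: "real \<Rightarrow> real \<Rightarrow> real \<Rightarrow> 4 \<Rightarrow> 4 \<Rightarrow> 4 \<Rightarrow> real" where
  "Y_bracket a1 a2 a3 i j k = half_bracket a1 a2 a3 i j k - half_bracket a1 a2 a3 j i k"

definition diag :: "('n \<Rightarrow> real) \<Rightarrow> 'n \<Rightarrow> 'n \<Rightarrow> real" where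
  "diag \<mu> i j = (if i = j then \<mu> i else 0)"

section \<open>The Ricci tensor of diagonal metrics\<close>

lemma frame_connection_diag:
  "frame_connection (diag \<mu>) (diag (\<lambda>i. 1 / \<mu> i)) c i j k
    = (c i j k * \<mu> k - c j k i * \<mu> i + c k i j * \<mu> j) / (2 * \<mu> k)"
  by (simp add: frame_connection_def diag_def if_distrib[of "\<lambda>x. _ * x"] if_distrib[of "\<lambda>x. x * _"]
      if_distrib[of "\<lambda>x. x / _"] sum.distrib sum_subtractf cong: if_cong)

text \<open>This component and the next two decide necessity: the squared sums of positive numbers
  here and in \<open>frame_ricci_24\<close> never vanish, the squared difference in
  \<open>frame_ricci_34\<close> may.\<close>

lemma frame_ricci_14:
  assumes "\<And>i. \<mu> i > 0"
  shows "frame_ricci (diag \<mu>) (diag (\<lambda>i. 1 / \<mu> i)) (Y_bracket a1 a2 a3) 1 4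
    = - a1 * (\<mu> 2 + \<mu> 3)\<^sup>2 / (2 * \<mu> 2 * \<mu> 3)"
  using assms[of 1] assms[of 2] assms[of 3] assms[of 4]
  by (simp add: frame_ricci_def frame_connection_diag sum_4 Y_bracket_def half_bracket_def)
    (simp add: field_simps power2_eq_square)

lemma frame_ricci_24:
  assumes "\<And>i. \<mu> i > 0"
  shows "frame_ricci (diag \<mu>) (diag (\<lambda>i. 1 / \<mu> i)) (Y_bracket a1 a2 a3) 2 4
    = - a2 * (\<mu> 1 + \<mu> 3)\<^sup>2 / (2 * \<mu> 1 * \<mu> 3)"
  using assms[of 1] assms[of 2] assms[of 3] assms[of 4]
  by (simp add: frame_ricci_def frame_connection_diag sum_4 Y_bracket_def half_bracket_def)
    (simp add: field_simps power2_eq_square)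

lemma frame_ricci_34:
  assumes "\<And>i. \<mu> i > 0"
  shows "frame_ricci (diag \<mu>) (diag (\<lambda>i. 1 / \<mu> i)) (Y_bracket a1 a2 a3) 3 4
    = - a3 * (\<mu> 1 - \<mu> 2)\<^sup>2 / (2 * \<mu> 1 * \<mu> 2)"
  using assms[of 1] assms[of 2] assms[of 3] assms[of 4]
  by (simp add: frame_ricci_def frame_connection_diag sum_4 Y_bracket_def half_bracket_def)
    (simp add: field_simps power2_eq_square)

lemma frame_ricci_off_diagonal:
  assumes "\<And>i. \<mu> i > 0" and "a3 = 0 \<or> \<mu> 1 = \<mu> 2" and "i \<noteq> j"
  shows "frame_ricci (diag \<mu>) (diag (\<lambda>i. 1 / \<mu> i)) (Y_bracket 0 0 a3) i j = 0"
proof -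
  have \<mu>: "\<mu> 1 \<noteq> 0" "\<mu> 2 \<noteq> 0" "\<mu> 3 \<noteq> 0" "\<mu> 4 \<noteq> 0"
    using assms(1) by (metis less_irrefl)+
  show ?thesis
    using assms(2)
  proof
    assume "a3 = 0"
    with exhaust_4[of i] exhaust_4[of j] \<open>i \<noteq> j\<close> show ?thesis
      by (elim disjE)
        (simp_all add: frame_ricci_def frame_connection_diag sum_4 Y_bracket_def half_bracket_def)
  next
    assume "\<mu> 1 = \<mu> 2"
    with exhaust_4[of i] exhaust_4[of j] \<open>i \<noteq> j\<close> \<mu> show ?thesis
      by (elim disjE)
        (simp_all add: frame_ricci_def frame_connection_diag sum_4 Y_bracket_def half_bracket_def)
  qed
qed

text \<open>For a1 = a2 = 0 the quarter turn sending vector 1 to 2 and 2 to minus 1, with 3 and 4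
  fixed, preserves the brackets, and it is an isometry once \<mu> 1 = \<mu> 2. This symmetry is
  behind the computation.\<close>

lemma frame_ricci_11_22:
  assumes "\<And>i. \<mu> i > 0" and "\<mu> 1 = \<mu> 2"
  shows "frame_ricci (diag \<mu>) (diag (\<lambda>i. 1 / \<mu> i)) (Y_bracket 0 0 a3) 1 1
    = frame_ricci (diag \<mu>) (diag (\<lambda>i. 1 / \<mu> i)) (Y_bracket 0 0 a3) 2 2"
  using assms(1)[of 1] assms(1)[of 2] assms(1)[of 3] assms(1)[of 4] assms(2)
  by (simp add: frame_ricci_def frame_connection_diag sum_4 Y_bracket_def half_bracket_def field_simps)

section \<open>Invariant subspaces of the flow\<close>

text \<open>Gronwall's argument for the sum of squares \<open>D\<close>, which is differentiable
  where the sum of absolute values need not be: the derivative of \<open>D\<close> is at most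
  \<open>L * D\<close>, so \<open>exp (- L * t) * D t\<close> cannot rise from 0.\<close>

lemma linear_system_zero:
  fixes f f' :: "'i \<Rightarrow> real \<Rightarrow> real"
  assumes I: "finite I"
    and f: "\<And>i t. i \<in> I \<Longrightarrow> 0 \<le> t \<Longrightarrow> t \<le> \<tau> \<Longrightarrow> (f i has_real_derivative f' i t) (at t within {0..\<tau>})"
    and le: "\<And>i t. i \<in> I \<Longrightarrow> 0 \<le> t \<Longrightarrow> t \<le> \<tau> \<Longrightarrow> \<bar>f' i t\<bar> \<le> K * (\<Sum>j\<in>I. \<bar>f j t\<bar>)"
    and init: "\<And>i. i \<in> I \<Longrightarrow> f i 0 = 0"
    and t: "0 \<le> t" "t \<le> \<tau>" and i: "i \<in> I"
  shows "f i t = 0"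
proof -
  define D where "D t = (\<Sum>i\<in>I. (f i t)\<^sup>2)" for t
  \<comment> \<open>The 2 comes from differentiating squares, \<open>card I\<close> from
    Cauchy-Schwarz for the sum of absolute values, and the absolute value admits any sign of
    \<open>K\<close>.\<close>
  define L where "L = 2 * \<bar>K\<bar> * card I"
  have D_deriv: "(D has_real_derivative (\<Sum>i\<in>I. 2 * f i s * f' i s)) (at s within {0..\<tau>})"
    if "0 \<le> s" "s \<le> \<tau>" for s
    unfolding D_def
    by (auto intro!: derivative_eq_intros f[OF _ that] sum.cong)
  have bound: "(\<Sum>i\<in>I. 2 * f i s * f' i s) \<le> L * D s" if s: "0 \<le> s" "s \<le> \<tau>" for s
  proof -
    define S where "S = (\<Sum>j\<in>I. \<bar>f j s\<bar>)"
    have S0: "S \<ge> 0" by (simp add: S_def sum_nonneg)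
    have "(\<Sum>i\<in>I. 2 * f i s * f' i s) \<le> (\<Sum>i\<in>I. 2 * \<bar>f i s\<bar> * (\<bar>K\<bar> * S))"
    proof (rule sum_mono)
      fix i assume i: "i \<in> I"
      have "K * S \<le> \<bar>K\<bar> * S" using S0 by (simp add: mult_right_mono)
      then have "\<bar>f' i s\<bar> \<le> \<bar>K\<bar> * S" using le[OF i s] by (simp add: S_def)
      then have "\<bar>f i s\<bar> * \<bar>f' i s\<bar> \<le> \<bar>f i s\<bar> * (\<bar>K\<bar> * S)" by (rule mult_left_mono) simp
      moreover have "f i s * f' i s \<le> \<bar>f i s\<bar> * \<bar>f' i s\<bar>" by (metis abs_ge_self abs_mult)
      ultimately show "2 * f i s * f' i s \<le> 2 * \<bar>f i s\<bar> * (\<bar>K\<bar> * S)" by simp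
    qed
    also have "\<dots> = 2 * \<bar>K\<bar> * S\<^sup>2"
      by (simp add: S_def power2_eq_square mult_ac flip: sum_distrib_left sum_distrib_right)
    also have "\<dots> \<le> 2 * \<bar>K\<bar> * ((\<Sum>i\<in>I. \<bar>f i s\<bar>\<^sup>2) * card I)"
      unfolding S_def by (intro mult_left_mono sum_squared_le_sum_of_squares) simp
    finally show ?thesis by (simp add: L_def D_def mult_ac)
  qed
  have "exp (- L * t) * D t \<le> exp (- L * 0) * D 0"
  proof (rule DERIV_nonpos_imp_decreasing_open[OF t(1), of "\<lambda>s. exp (- L * s) * D s"])
    fix s assume s: "0 < s" "s < t"
    have "at s within {0..\<tau>} = at s" using s t by (simp add: at_within_Icc_at)
    then have "(D has_real_derivative (\<Sum>i\<in>I. 2 * f i s * f' i s)) (at s)"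
      using D_deriv[of s] s t by simp
    then have "((\<lambda>s. exp (- L * s) * D s) has_real_derivative
        exp (- L * s) * ((\<Sum>i\<in>I. 2 * f i s * f' i s) - L * D s)) (at s)"
      by (auto intro!: derivative_eq_intros simp: algebra_simps)
    moreover have "exp (- L * s) * ((\<Sum>i\<in>I. 2 * f i s * f' i s) - L * D s) \<le> 0"
      using bound[of s] s t by (simp add: mult_nonneg_nonpos)
    ultimately show "\<exists>y. ((\<lambda>s. exp (- L * s) * D s) has_real_derivative y) (at s) \<and> y \<le> 0" by blast
  next
    have "continuous_on {0..\<tau>} D"
      by (rule DERIV_continuous_on[OF D_deriv]) auto
    then have "continuous_on {0..t} D"
      by (rule continuous_on_subset) (use t in auto)
    then show "continuous_on {0..t} (\<lambda>s. exp (- L * s) * D s)"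
      by (intro continuous_intros)
  qed
  also have "\<dots> = 0" by (simp add: D_def init)
  finally have "D t \<le> 0" by (simp add: mult_le_0_iff)
  then have "D t = 0" by (simp add: D_def sum_nonneg order_antisym)
  then show ?thesis using I i by (simp add: D_def sum_nonneg_eq_0_iff)
qed

text \<open>
  Lipschitz estimates along a solution: this relation is preserved by the arithmetic operations that
  make up the Ricci tensor, so no derivative of that rational function is needed.
\<close>

definition near :: "'a set \<Rightarrow> ('a \<Rightarrow> real) \<Rightarrow> ('a \<Rightarrow> real) \<Rightarrow> ('a \<Rightarrow> real) \<Rightarrow> bool" where
  "near S \<delta> u v \<longleftrightarrow> (\<exists>K\<ge>0. \<forall>t\<in>S. \<bar>u t\<bar> \<le> K \<and> \<bar>v t\<bar> \<le> K \<and> \<bar>u t - v t\<bar> \<le> K * \<delta> t)"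

context
  fixes S :: "'a set" and \<delta> :: "'a \<Rightarrow> real"
  assumes \<delta>: "\<And>t. t \<in> S \<Longrightarrow> \<delta> t \<ge> 0"
begin

lemma near_const: "near S \<delta> (\<lambda>t. r) (\<lambda>t. r)"
  unfolding near_def by (rule exI[of _ "\<bar>r\<bar>"]) (simp add: \<delta>)

lemma near_add:
  assumes "near S \<delta> u u'" "near S \<delta> v v'"
  shows "near S \<delta> (\<lambda>t. u t + v t) (\<lambda>t. u' t + v' t)"
proof -
  obtain K L where K: "K \<ge> 0" "\<forall>t\<in>S. \<bar>u t\<bar> \<le> K \<and> \<bar>u' t\<bar> \<le> K \<and> \<bar>u t - u' t\<bar> \<le> K * \<delta> t"
    and L: "L \<ge> 0" "\<forall>t\<in>S. \<bar>v t\<bar> \<le> L \<and> \<bar>v' t\<bar> \<le> L \<and> \<bar>v t - v' t\<bar> \<le> L * \<delta> t"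
    using assms unfolding near_def by blast
  have "\<bar>u t + v t\<bar> \<le> K + L \<and> \<bar>u' t + v' t\<bar> \<le> K + L \<and> \<bar>u t + v t - (u' t + v' t)\<bar> \<le> (K + L) * \<delta> t"
    if "t \<in> S" for t
    using K(2)[rule_format, OF that] L(2)[rule_format, OF that] unfolding distrib_right by linarith
  then show ?thesis unfolding near_def using K(1) L(1) by (intro exI[of _ "K + L"]) simp
qed

text \<open>One factor is changed at a time; the constant 2 collects the two resulting
  terms.\<close>

lemma near_mult:
  assumes "near S \<delta> u u'" "near S \<delta> v v'"
  shows "near S \<delta> (\<lambda>t. u t * v t) (\<lambda>t. u' t * v' t)"
proof -
  obtain K L where K: "K \<ge> 0" "\<forall>t\<in>S. \<bar>u t\<bar> \<le> K \<and> \<bar>u' t\<bar> \<le> K \<and> \<bar>u t - u' t\<bar> \<le> K * \<delta> t"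
    and L: "L \<ge> 0" "\<forall>t\<in>S. \<bar>v t\<bar> \<le> L \<and> \<bar>v' t\<bar> \<le> L \<and> \<bar>v t - v' t\<bar> \<le> L * \<delta> t"
    using assms unfolding near_def by blast
  have "\<bar>u t * v t\<bar> \<le> 2 * (K * L) \<and> \<bar>u' t * v' t\<bar> \<le> 2 * (K * L)
      \<and> \<bar>u t * v t - u' t * v' t\<bar> \<le> 2 * (K * L) * \<delta> t" if "t \<in> S" for t
  proof -
    note b = K(2)[rule_format, OF that] L(2)[rule_format, OF that]
    have KL: "K * L \<ge> 0" using K L by simp
    have 1: "\<bar>u t * v t\<bar> \<le> K * L" "\<bar>u' t * v' t\<bar> \<le> K * L"
      using b K(1) by (auto simp: abs_mult intro!: mult_mono)
    have "u t * v t - u' t * v' t = u t * (v t - v' t) + (u t - u' t) * v' t" by (simp add: algebra_simps)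
    moreover have "\<bar>u t * (v t - v' t)\<bar> \<le> K * (L * \<delta> t)"
      using b K(1) by (auto simp: abs_mult intro!: mult_mono)
    moreover have "\<bar>(u t - u' t) * v' t\<bar> \<le> (K * \<delta> t) * L"
      using b K(1) \<delta>[OF that] by (auto simp: abs_mult intro!: mult_mono)
    ultimately have "\<bar>u t * v t - u' t * v' t\<bar> \<le> 2 * (K * L) * \<delta> t" by (simp add: mult_ac)
    with 1 KL show ?thesis by linarith
  qed
  then show ?thesis unfolding near_def using K(1) L(1) by (intro exI[of _ "2 * (K * L)"]) simp
qed

lemma near_diff:
  assumes "near S \<delta> u u'" "near S \<delta> v v'"
  shows "near S \<delta> (\<lambda>t. u t - v t) (\<lambda>t. u' t - v' t)"
  using near_add[OF assms(1) near_mult[OF near_const[of "- 1"] assms(2)]] by simp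

lemma near_sum:
  "finite I \<Longrightarrow> (\<And>i. i \<in> I \<Longrightarrow> near S \<delta> (u i) (v i)) \<Longrightarrow>
    near S \<delta> (\<lambda>t. \<Sum>i\<in>I. u i t) (\<lambda>t. \<Sum>i\<in>I. v i t)"
  by (induction I rule: finite_induct) (auto intro: near_add near_const)

lemma near_prod:
  "finite I \<Longrightarrow> (\<And>i. i \<in> I \<Longrightarrow> near S \<delta> (u i) (v i)) \<Longrightarrow>
    near S \<delta> (\<lambda>t. \<Prod>i\<in>I. u i t) (\<lambda>t. \<Prod>i\<in>I. v i t)"
  by (induction I rule: finite_induct) (auto intro: near_mult near_const)

text \<open>Inverses differ by the original difference divided by both values, so the common lower
  bound \<open>m\<close> makes the constant uniform on \<open>S\<close>.\<close>

lemma near_inverse: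
  assumes "near S \<delta> u v" and m: "m > 0" "\<And>t. t \<in> S \<Longrightarrow> \<bar>u t\<bar> \<ge> m" "\<And>t. t \<in> S \<Longrightarrow> \<bar>v t\<bar> \<ge> m"
  shows "near S \<delta> (\<lambda>t. inverse (u t)) (\<lambda>t. inverse (v t))"
proof -
  obtain K where K: "K \<ge> 0" "\<forall>t\<in>S. \<bar>u t\<bar> \<le> K \<and> \<bar>v t\<bar> \<le> K \<and> \<bar>u t - v t\<bar> \<le> K * \<delta> t"
    using assms(1) unfolding near_def by blast
  define L where "L = inverse m + inverse m * K * inverse m"
  have L: "inverse m \<le> L" "inverse m * K * inverse m \<le> L" using m(1) K(1) by (auto simp: L_def)
  have "\<bar>inverse (u t)\<bar> \<le> L \<and> \<bar>inverse (v t)\<bar> \<le> L \<and> \<bar>inverse (u t) - inverse (v t)\<bar> \<le> L * \<delta> t"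
    if t: "t \<in> S" for t
  proof -
    have b: "\<bar>inverse (u t)\<bar> \<le> inverse m" "\<bar>inverse (v t)\<bar> \<le> inverse m"
      using m(1) m(2,3)[OF t] by (auto simp: abs_inverse intro!: le_imp_inverse_le)
    have "u t \<noteq> 0" "v t \<noteq> 0" using m(1) m(2,3)[OF t] by auto
    then have "inverse (u t) - inverse (v t) = - (inverse (u t) * (u t - v t) * inverse (v t))"
      by (rule division_ring_inverse_diff[THEN trans]) (simp add: algebra_simps)
    then have "\<bar>inverse (u t) - inverse (v t)\<bar> = \<bar>inverse (u t)\<bar> * \<bar>u t - v t\<bar> * \<bar>inverse (v t)\<bar>"
      by (simp add: abs_mult)
    also have "\<dots> \<le> inverse m * (K * \<delta> t) * inverse m"
      using b K \<delta>[OF t] t m(1) by (intro mult_mono) auto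
    also have "\<dots> = (inverse m * K * inverse m) * \<delta> t" by (simp add: mult_ac)
    also have "\<dots> \<le> L * \<delta> t" using L(2) \<delta>[OF t] by (rule mult_right_mono)
    finally show ?thesis using b L by linarith
  qed
  moreover have "L \<ge> 0" using m(1) K(1) by (simp add: L_def)
  ultimately show ?thesis unfolding near_def by blast
qed

lemma near_det:
  fixes M N :: "'a \<Rightarrow> real ^ 'n ^ 'n"
  assumes "\<And>i j. near S \<delta> (\<lambda>t. M t $ i $ j) (\<lambda>t. N t $ i $ j)"
  shows "near S \<delta> (\<lambda>t. det (M t)) (\<lambda>t. det (N t))"
  unfolding det_def
  by (intro near_sum near_mult near_const near_prod assms) (simp_all add: finite_permutations)

text \<open>The components are polynomial in the entries of \<open>G\<close> and \<open>H\<close>;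
  division occurs only in forming the inverse, which is treated separately.\<close>

lemma near_frame_ricci:
  assumes G: "\<And>i j. near S \<delta> (\<lambda>t. G t i j) (\<lambda>t. G' t i j)"
    and H: "\<And>i j. near S \<delta> (\<lambda>t. H t i j) (\<lambda>t. H' t i j)"
  shows "near S \<delta> (\<lambda>t. frame_ricci (G t) (H t) c i j) (\<lambda>t. frame_ricci (G' t) (H' t) c i j)"
proof -
  have "near S \<delta> (\<lambda>t. frame_connection (G t) (H t) c i j k) (\<lambda>t. frame_connection (G' t) (H' t) c i j k)" for i j k
    unfolding frame_connection_def divide_inverse
    by (intro near_sum near_mult near_add near_diff near_const G H finite_class.finite_UNIV)
  then show ?thesis
    unfolding frame_ricci_def
    by (intro near_sum near_mult near_add near_diff near_const finite_class.finite_UNIV)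
qed

end

text \<open>Cramer's rule exhibits the entries of the inverse as quotients of determinants.\<close>

definition gram_inverse :: "('n::finite \<Rightarrow> 'n \<Rightarrow> real) \<Rightarrow> 'n \<Rightarrow> 'n \<Rightarrow> real" where
  "gram_inverse G k j = det (\<chi> i l. if l = k then axis j 1 $ i else G i l) * inverse (det (\<chi> i l. G i l))"

text \<open>Cramer's rule gives the columns of a right inverse, which for a square matrix is also a
  left inverse.\<close>

lemma gram_inverse:
  assumes "det (\<chi> i l. G i l) \<noteq> 0"
  shows "(\<Sum>m\<in>UNIV. G i m * gram_inverse G m j) = (if i = j then 1 else 0)"
    and "(\<Sum>m\<in>UNIV. gram_inverse G i m * G m j) = (if i = j then 1 else 0)"
proof -
  let ?A = "\<chi> i l. G i l" and ?B = "\<chi> k j. gram_inverse G k j"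
  have 1: "(\<Sum>m\<in>UNIV. G i m * gram_inverse G m j) = (if i = j then 1 else 0)" for i j
  proof -
    have "?A *v (\<chi> k. gram_inverse G k j) = axis j 1"
      unfolding cramer[OF assms] by (simp only: gram_inverse_def divide_inverse vec_lambda_beta)
    then have "(?A *v (\<chi> k. gram_inverse G k j)) $ i = axis j 1 $ i" by simp
    then show ?thesis by (simp add: matrix_vector_mult_def axis_def)
  qed
  have "?A ** ?B = mat 1" by (simp add: matrix_matrix_mult_def mat_def vec_eq_iff 1)
  then have "?B ** ?A = mat 1" by (rule matrix_left_right_inverse[THEN iffD1])
  then have "(?B ** ?A) $ i $ j = mat 1 $ i $ j" by simp
  then show "(\<Sum>m\<in>UNIV. gram_inverse G i m * G m j) = (if i = j then 1 else 0)"
    by (simp add: matrix_matrix_mult_def mat_def)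
  show "(\<Sum>m\<in>UNIV. G i m * gram_inverse G m j) = (if i = j then 1 else 0)" by (rule 1)
qed

lemma det_diag: "det (\<chi> i j. diag \<mu> i j) = (\<Prod>i\<in>UNIV. \<mu> i)"
  by (subst det_diagonal) (simp_all add: diag_def)

lemma gram_inverse_diag:
  assumes "\<And>i. \<mu> i \<noteq> 0"
  shows "gram_inverse (diag \<mu>) = diag (\<lambda>i. 1 / \<mu> i)"
proof (intro ext)
  fix i j
  have "det (\<chi> i j. diag \<mu> i j) \<noteq> 0" using assms by (simp add: det_diag)
  from gram_inverse(1)[OF this, of i j] have "\<mu> i * gram_inverse (diag \<mu>) i j = (if i = j then 1 else 0)"
    by (simp add: diag_def[of \<mu> i] if_distrib[of "\<lambda>x. x * _"] cong: if_cong)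
  then show "gram_inverse (diag \<mu>) i j = diag (\<lambda>i. 1 / \<mu> i) i j"
    using assms[of i] by (cases "i = j") (simp_all add: diag_def[of "\<lambda>i. 1 / \<mu> i"] field_simps)
qed

text \<open>
  For an involution \<open>\<rho>\<close>, the projection onto the diagonal matrices with \<open>\<rho>\<close>-invariant diagonal: the
  identity serves part (i), the transposition of \<open>1\<close> and \<open>2\<close> part (ii).
\<close>

definition symmetrize :: "('n \<Rightarrow> 'n) \<Rightarrow> ('n \<Rightarrow> 'n \<Rightarrow> real) \<Rightarrow> 'n \<Rightarrow> 'n \<Rightarrow> real" where
  "symmetrize \<rho> M = diag (\<lambda>i. (M i i + M (\<rho> i) (\<rho> i)) / 2)"

lemma continuous_nonzero_bounded_below:
  fixes f :: "'a::topological_space \<Rightarrow> real"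
  assumes "compact S" "continuous_on S f" "\<And>t. t \<in> S \<Longrightarrow> f t \<noteq> 0"
  obtains m where "m > 0" "\<And>t. t \<in> S \<Longrightarrow> m \<le> \<bar>f t\<bar>"
proof (cases "S = {}")
  case False
  then obtain x where "x \<in> S" "\<And>y. y \<in> S \<Longrightarrow> \<bar>f x\<bar> \<le> \<bar>f y\<bar>"
    using continuous_attains_inf[OF assms(1), of "\<lambda>t. \<bar>f t\<bar>"] assms(2) by (auto intro: continuous_on_rabs)
  then show ?thesis using that[of "\<bar>f x\<bar>"] assms(3) by auto
qed (use that[of 1] in auto)

text \<open>Compactness keeps the nonvanishing determinants away from 0, as
  \<open>near_inverse\<close> demands; the numerators are determinants with one constant
  column.\<close>

lemma near_gram_inverse:
  fixes G G' :: "'a::topological_space \<Rightarrow> 'n::finite \<Rightarrow> 'n \<Rightarrow> real"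
  assumes \<delta>: "\<And>t. t \<in> S \<Longrightarrow> \<delta> t \<ge> 0" and S: "compact S"
    and G: "\<And>i j. near S \<delta> (\<lambda>t. G t i j) (\<lambda>t. G' t i j)"
    and cont: "\<And>i j. continuous_on S (\<lambda>t. G t i j)" "\<And>i j. continuous_on S (\<lambda>t. G' t i j)"
    and det: "\<And>t. t \<in> S \<Longrightarrow> det (\<chi> i j. G t i j) \<noteq> 0" "\<And>t. t \<in> S \<Longrightarrow> det (\<chi> i j. G' t i j) \<noteq> 0"
  shows "near S \<delta> (\<lambda>t. gram_inverse (G t) i j) (\<lambda>t. gram_inverse (G' t) i j)"
proof -
  have c: "continuous_on S (\<lambda>t. det (\<chi> i j. M t i j))"
    if "\<And>i j. continuous_on S (\<lambda>t. M t i j)" for M :: "'a \<Rightarrow> 'n \<Rightarrow> 'n \<Rightarrow> real"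
    unfolding det_def using that by (auto intro!: continuous_intros)
  obtain m where m: "m > 0" "\<And>t. t \<in> S \<Longrightarrow> m \<le> \<bar>det (\<chi> i j. G t i j)\<bar>"
    using continuous_nonzero_bounded_below[OF S c[of G, OF cont(1)] det(1)] by blast
  obtain m' where m': "m' > 0" "\<And>t. t \<in> S \<Longrightarrow> m' \<le> \<bar>det (\<chi> i j. G' t i j)\<bar>"
    using continuous_nonzero_bounded_below[OF S c[of G', OF cont(2)] det(2)] by blast
  have "near S \<delta> (\<lambda>t. (\<chi> k l. if l = i then axis j 1 $ k else G t k l) $ k $ l)
      (\<lambda>t. (\<chi> k l. if l = i then axis j 1 $ k else G' t k l) $ k $ l)" for k l
    by (cases "l = i") (simp_all add: near_const[OF \<delta>] G)
  moreover have "near S \<delta> (\<lambda>t. inverse (det (\<chi> i l. G t i l))) (\<lambda>t. inverse (det (\<chi> i l. G' t i l)))"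
  proof (rule near_inverse[OF \<delta>])
    show "near S \<delta> (\<lambda>t. det (\<chi> i l. G t i l)) (\<lambda>t. det (\<chi> i l. G' t i l))"
      by (rule near_det[OF \<delta>]) (simp_all add: G)
    show "min m m' > 0" using m m' by simp
  qed (use m(2) m'(2) in \<open>auto simp: min_le_iff_disj\<close>)
  ultimately show ?thesis
    unfolding gram_inverse_def by (intro near_mult[OF \<delta>] near_det[OF \<delta>])
qed

text \<open>The projection is linear, so \<open>G - P\<close> has derivative -2 times the difference
  of \<open>R\<close> and its projection. By \<open>inv\<close> the Ricci tensor \<open>R'\<close>
  of \<open>P\<close> equals its own projection, so this difference is controlled by
  \<open>R - R'\<close>, hence by the distance of \<open>G\<close> from \<open>P\<close>.\<close>

lemma ricci_flow_symmetrize: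
  fixes G :: "real \<Rightarrow> 'n::finite \<Rightarrow> 'n \<Rightarrow> real"
  assumes flow: "\<And>i j t. 0 \<le> t \<Longrightarrow> t \<le> \<tau> \<Longrightarrow>
      ((\<lambda>s. G s i j) has_real_derivative - 2 * frame_ricci (G t) (gram_inverse (G t)) c i j) (at t within {0..\<tau>})"
    and det: "\<And>t. 0 \<le> t \<Longrightarrow> t \<le> \<tau> \<Longrightarrow> det (\<chi> i j. G t i j) \<noteq> 0"
    and pos: "\<And>t i. 0 \<le> t \<Longrightarrow> t \<le> \<tau> \<Longrightarrow> G t i i > 0"
    and \<rho>: "\<And>i. \<rho> (\<rho> i) = i"
    and init: "symmetrize \<rho> (G 0) = G 0"
    and inv: "\<And>\<mu>. (\<And>i. \<mu> i > 0) \<Longrightarrow> (\<And>i. \<mu> (\<rho> i) = \<mu> i) \<Longrightarrow>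
      symmetrize \<rho> (frame_ricci (diag \<mu>) (diag (\<lambda>i. 1 / \<mu> i)) c) = frame_ricci (diag \<mu>) (diag (\<lambda>i. 1 / \<mu> i)) c"
    and t: "0 \<le> t" "t \<le> \<tau>"
  shows "symmetrize \<rho> (G t) = G t"
proof -
  define P where "P t = symmetrize \<rho> (G t)" for t
  define \<mu> where "\<mu> t i = (G t i i + G t (\<rho> i) (\<rho> i)) / 2" for t i
  have P: "P t = diag (\<mu> t)" for t
    by (simp add: P_def symmetrize_def \<mu>_def [abs_def])
  define R where "R t = frame_ricci (G t) (gram_inverse (G t)) c" for t
  define R' where "R' t = frame_ricci (P t) (gram_inverse (P t)) c" for t
  define \<delta> where "\<delta> t = (\<Sum>(i, j)\<in>UNIV. \<bar>G t i j - P t i j\<bar>)" for t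
  have \<delta>: "\<delta> t \<ge> 0" for t by (auto simp: \<delta>_def intro!: sum_nonneg)
  \<comment> \<open>Averages of positive diagonal entries are positive, so \<open>inv\<close>
    applies to \<open>P\<close> and the determinant of \<open>P\<close> does not vanish.\<close>
  have \<mu>_pos: "\<mu> t i > 0" if "t \<in> {0..\<tau>}" for t i
    using pos[of t i] pos[of t "\<rho> i"] that by (simp add: \<mu>_def)
  have R': "symmetrize \<rho> (R' t) = R' t" if "t \<in> {0..\<tau>}" for t
    using inv[of "\<mu> t"] \<mu>_pos[OF that] gram_inverse_diag[of "\<mu> t"]
    by (simp add: R'_def P \<mu>_def \<rho> add.commute less_imp_neq[symmetric])
  have cont: "continuous_on {0..\<tau>} (\<lambda>t. G t i j)" for i j
    by (rule DERIV_continuous_on[OF flow]) auto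
  have contP: "continuous_on {0..\<tau>} (\<lambda>t. P t i j)" for i j
    unfolding P diag_def \<mu>_def by (cases "i = j") (auto intro!: continuous_intros cont)
  have near_G: "near {0..\<tau>} \<delta> (\<lambda>t. G t i j) (\<lambda>t. P t i j)" for i j
  proof -
    have "bounded ((\<lambda>t. G t i j) ` {0..\<tau>})" "bounded ((\<lambda>t. P t i j) ` {0..\<tau>})"
      by (intro compact_imp_bounded compact_continuous_image cont contP compact_Icc)+
    then obtain B B' where B: "\<forall>t\<in>{0..\<tau>}. \<bar>G t i j\<bar> \<le> B" "\<forall>t\<in>{0..\<tau>}. \<bar>P t i j\<bar> \<le> B'"
      by (auto simp: bounded_iff)
    have "\<bar>G t i j - P t i j\<bar> \<le> \<delta> t" for t
      using member_le_sum[of "(i, j)" UNIV "\<lambda>(i, j). \<bar>G t i j - P t i j\<bar>"] by (simp add: \<delta>_def split_def)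
    also have "\<dots> t \<le> (1 + \<bar>B\<bar> + \<bar>B'\<bar>) * \<delta> t" for t
      using mult_right_mono[of 1 "1 + \<bar>B\<bar> + \<bar>B'\<bar>" "\<delta> t"] \<delta>[of t] by simp
    finally show ?thesis
      unfolding near_def using B by (intro exI[of _ "1 + \<bar>B\<bar> + \<bar>B'\<bar>"]) force
  qed
  have "near {0..\<tau>} \<delta> (\<lambda>t. R t i j) (\<lambda>t. R' t i j)" for i j
    unfolding R_def R'_def
  proof (intro near_frame_ricci near_gram_inverse near_G cont contP \<delta> compact_Icc det)
    show "det (\<chi> i j. P t i j) \<noteq> 0" if "t \<in> {0..\<tau>}" for t
      using \<mu>_pos[OF that] by (simp add: P det_diag less_imp_neq[symmetric])
  qed auto
  then have "\<forall>i j. \<exists>K\<ge>0. \<forall>t\<in>{0..\<tau>}. \<bar>R t i j - R' t i j\<bar> \<le> K * \<delta> t"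
    unfolding near_def by blast
  then obtain K where K: "\<And>i j. K i j \<ge> 0" "\<And>i j t. t \<in> {0..\<tau>} \<Longrightarrow> \<bar>R t i j - R' t i j\<bar> \<le> K i j * \<delta> t"
    by metis
  define L where "L = (\<Sum>(i, j)\<in>UNIV. K i j)"
  have R: "\<bar>R t i j - R' t i j\<bar> \<le> L * \<delta> t" if "t \<in> {0..\<tau>}" for t i j
  proof -
    have "K i j \<le> L"
      using member_le_sum[of "(i, j)" UNIV "\<lambda>(i, j). K i j"] K(1) by (simp add: L_def split_def)
    then show ?thesis using K(2)[OF that, of i j] mult_right_mono[of "K i j" L "\<delta> t"] \<delta>[of t] by linarith
  qed
  define f where "f q t = G t (fst q) (snd q) - P t (fst q) (snd q)" for q t
  define f' where "f' q t = - 2 * (R t (fst q) (snd q) - symmetrize \<rho> (R t) (fst q) (snd q))" for q t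
  have "f (i, j) t = 0" for i j
  proof (rule linear_system_zero[of "UNIV :: ('n \<times> 'n) set" \<tau> f f' "4 * L"])
    fix q :: "'n \<times> 'n" and t :: real assume t: "0 \<le> t" "t \<le> \<tau>"
    define a b where "a = fst q" and "b = snd q"
    have G: "((\<lambda>s. G s i j) has_real_derivative - (2 * R t i j)) (at t within {0..\<tau>})" for i j
      using flow[OF t] by (simp add: R_def)
    have "((\<lambda>s. G s a b - (if a = b then (G s a a + G s (\<rho> a) (\<rho> a)) / 2 else 0)) has_real_derivative
        (- 2 * R t a b - (if a = b then (- 2 * R t a a + - 2 * R t (\<rho> a) (\<rho> a)) / 2 else 0))) (at t within {0..\<tau>})"
      by (cases "a = b") (auto intro!: derivative_eq_intros G)
    moreover have "f q = (\<lambda>s. G s a b - (if a = b then (G s a a + G s (\<rho> a) (\<rho> a)) / 2 else 0))"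
      by (rule ext) (simp add: f_def P diag_def \<mu>_def a_def b_def)
    moreover have "f' q t = - 2 * R t a b - (if a = b then (- 2 * R t a a + - 2 * R t (\<rho> a) (\<rho> a)) / 2 else 0)"
      by (auto simp: f'_def symmetrize_def diag_def a_def b_def field_simps)
    ultimately show "(f q has_real_derivative f' q t) (at t within {0..\<tau>})" by simp
    have t': "t \<in> {0..\<tau>}" using t by simp
    have avg: "\<bar>(a + b) / 2 - (c + d) / 2\<bar> \<le> e" if "\<bar>a - c\<bar> \<le> e" "\<bar>b - d\<bar> \<le> e" for a b c d e :: real
      using that by (auto simp: abs_le_iff field_simps)
    \<comment> \<open>\<open>R'\<close> is inserted and its projection removed at no cost. Averaging
      does not enlarge entrywise bounds, so each of the two differences is at most
      \<open>L * \<delta> t\<close>; the factor -2 makes this 4.\<close>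
    have "f' q t = - 2 * ((R t a b - R' t a b) - (symmetrize \<rho> (R t) a b - symmetrize \<rho> (R' t) a b))"
      by (simp add: f'_def R'[OF t'] a_def b_def)
    moreover have "\<bar>symmetrize \<rho> (R t) a b - symmetrize \<rho> (R' t) a b\<bar> \<le> L * \<delta> t"
      using avg[OF R[OF t', of a a] R[OF t', of "\<rho> a" "\<rho> a"]] R[OF t', of a b]
      by (cases "a = b") (simp_all add: symmetrize_def diag_def)
    moreover have "\<bar>- 2 * (x - y)\<bar> \<le> 4 * e" if "\<bar>x\<bar> \<le> e" "\<bar>y\<bar> \<le> e" for x y e :: real
      using that by (auto simp: abs_le_iff)
    ultimately have "\<bar>f' q t\<bar> \<le> 4 * (L * \<delta> t)" using R[OF t', of a b] by metis
    then show "\<bar>f' q t\<bar> \<le> 4 * L * (\<Sum>r\<in>UNIV. \<bar>f r t\<bar>)"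
      by (simp add: \<delta>_def f_def split_def mult.assoc)
  qed (use t in \<open>auto simp: f_def P_def init\<close>)
  then show ?thesis by (simp add: f_def P_def fun_eq_iff)
qed

section \<open>Gram matrices of tangent vectors and left invariance\<close>

context smooth_manifold
begin

lemma tangent_space_sum:
  assumes "\<And>i. i \<in> I \<Longrightarrow> u i \<in> tangent_space A p" "finite I"
  shows "(\<lambda>c. \<Sum>i\<in>I. r i *\<^sub>R u i c) \<in> tangent_space A p"
  using assms(2,1)
proof (induction I rule: finite_induct)
  case empty
  have "tangent_of_coords A (chart_at A p) p 0 = (\<lambda>c. 0)"
    using tangent_of_coords_scaleR[OF chart_at, of p 0 0] by simp
  then show ?case using tangent_of_coords_in[OF chart_at, of p 0] by simp
qed (simp add: tangent_space_add_scaleR)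

lemma metric_add_scaleR:
  assumes g: "riemannian_metric A g"
    and T: "u \<in> tangent_space A p" "v \<in> tangent_space A p" "w \<in> tangent_space A p"
  shows "g p (\<lambda>c. r *\<^sub>R u c + v c) w = r * g p u w + g p v w"
    and "g p w (\<lambda>c. r *\<^sub>R u c + v c) = r * g p w u + g p w v"
proof -
  have sym: "g p x y = g p y x" and scale: "g p (\<lambda>c. s *\<^sub>R x c) y = s * g p x y"
    and add: "z \<in> tangent_space A p \<Longrightarrow> g p (\<lambda>c. x c + y c) z = g p x z + g p y z"
    if "x \<in> tangent_space A p" "y \<in> tangent_space A p" for x y z s
    using g that unfolding riemannian_metric_def by blast+
  have "(\<lambda>c. \<Sum>i\<in>{()}. r *\<^sub>R u c) \<in> tangent_space A p"
    using T by (intro tangent_space_sum) auto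
  then have "(\<lambda>c. r *\<^sub>R u c) \<in> tangent_space A p" by simp
  then show 1: "g p (\<lambda>c. r *\<^sub>R u c + v c) w = r * g p u w + g p v w"
    using T by (simp add: add scale)
  show "g p w (\<lambda>c. r *\<^sub>R u c + v c) = r * g p w u + g p w v"
    using 1 T sym[OF T(3) tangent_space_add_scaleR[OF T(1,2)]] sym[OF T(3,1)] sym[OF T(3,2)] by simp
qed

lemma metric_sum:
  assumes g: "riemannian_metric A g" and w: "w \<in> tangent_space A p"
    and u: "\<And>i. i \<in> I \<Longrightarrow> u i \<in> tangent_space A p" and I: "finite I"
  shows "g p (\<lambda>c. \<Sum>i\<in>I. r i *\<^sub>R u i c) w = (\<Sum>i\<in>I. r i * g p (u i) w)"
  using I u
proof (induction I rule: finite_induct)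
  case empty
  \<comment> \<open>The zero vector is written as minus \<open>w\<close> plus \<open>w\<close>, so
    that linearity yields the value 0.\<close>
  have "(\<lambda>c. - 1 *\<^sub>R w c + w c) = (\<lambda>c. 0)" by auto
  then show ?case using metric_add_scaleR(1)[OF g w w w, of "- 1"] by simp
next
  case (insert i I)
  then have "(\<lambda>c. \<Sum>i\<in>I. r i *\<^sub>R u i c) \<in> tangent_space A p" by (intro tangent_space_sum) auto
  with insert show ?case using metric_add_scaleR(1)[OF g _ _ w] by simp
qed

text \<open>A kernel vector of the Gram matrix gives a combination \<open>z\<close> orthogonal to
  every \<open>u i\<close>, hence to itself. Positivity makes \<open>z\<close> vanish, and
  independence its coefficients.\<close>

lemma gram_det_nonzero:
  fixes u :: "'n::finite \<Rightarrow> ('g, 'e) tangent"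
  assumes g: "riemannian_metric A g" and u: "\<And>i. u i \<in> tangent_space A p"
    and ind: "\<And>r i. (\<lambda>c. \<Sum>i\<in>UNIV. r i *\<^sub>R u i c) = (\<lambda>c. 0) \<Longrightarrow> r i = 0"
  shows "det (\<chi> i j. g p (u i) (u j)) \<noteq> 0"
proof
  assume "det (\<chi> i j. g p (u i) (u j)) = 0"
  then obtain x where x: "x \<noteq> 0" "(\<chi> i j. g p (u i) (u j)) *v x = 0"
    by (metis invertible_det_nz invertible_left_inverse matrix_left_invertible_ker)
  define z where "z = (\<lambda>c. \<Sum>i\<in>UNIV. (x $ i) *\<^sub>R u i c)"
  have z: "z \<in> tangent_space A p" unfolding z_def by (rule tangent_space_sum) (simp_all add: u)
  have "g p (u i) z = 0" for i
  proof -
    have "g p (u i) z = g p z (u i)" using g u z unfolding riemannian_metric_def by blast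
    also have "\<dots> = (\<Sum>j\<in>UNIV. x $ j * g p (u j) (u i))"
      unfolding z_def by (rule metric_sum[OF g]) (simp_all add: u)
    also have "\<dots> = (\<Sum>j\<in>UNIV. g p (u i) (u j) * x $ j)"
      using g u unfolding riemannian_metric_def by (intro sum.cong refl) (metis mult.commute)
    also have "\<dots> = ((\<chi> i j. g p (u i) (u j)) *v x) $ i"
      by (simp add: matrix_vector_mult_def)
    finally show ?thesis using x by simp
  qed
  moreover have "g p z z = (\<Sum>j\<in>UNIV. x $ j * g p (u j) z)"
    using metric_sum[OF g z, of UNIV u "\<lambda>i. x $ i"] u by (simp flip: z_def)
  ultimately have "g p z z = 0" by simp
  then have "z = (\<lambda>c. 0)" using g z unfolding riemannian_metric_def by (metis less_irrefl)
  then have "x $ i = 0" for i using ind unfolding z_def by blast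
  then show False using x by (simp add: vec_eq_iff)
qed

end

text \<open>Left translation by \<open>p\<close> takes the identity to \<open>p\<close> and carries
  the values of invariant fields along.\<close>

lemma left_invariant_metric_constant:
  assumes "lie_group G A" and g: "left_invariant_metric G A g"
    and UV: "U \<in> lie_algebra G A" "V \<in> lie_algebra G A"
  shows "g p (U p) (V p) = g \<one>\<^bsub>G\<^esub> (U \<one>\<^bsub>G\<^esub>) (V \<one>\<^bsub>G\<^esub>)"
proof -
  interpret lie_group G A by fact
  have "U \<one>\<^bsub>G\<^esub> \<in> tangent_space A \<one>\<^bsub>G\<^esub>" "V \<one>\<^bsub>G\<^esub> \<in> tangent_space A \<one>\<^bsub>G\<^esub>"
    using UV by (auto simp: lie_algebra_def smooth_vector_field_def)
  then have "g (p \<otimes>\<^bsub>G\<^esub> \<one>\<^bsub>G\<^esub>) (differential A (\<lambda>q. p \<otimes>\<^bsub>G\<^esub> q) \<one>\<^bsub>G\<^esub> (U \<one>\<^bsub>G\<^esub>)) (differential A (\<lambda>q. p \<otimes>\<^bsub>G\<^esub> q) \<one>\<^bsub>G\<^esub> (V \<one>\<^bsub>G\<^esub>))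
      = g \<one>\<^bsub>G\<^esub> (U \<one>\<^bsub>G\<^esub>) (V \<one>\<^bsub>G\<^esub>)"
    using g unfolding left_invariant_metric_def by blast
  moreover have "U (p \<otimes>\<^bsub>G\<^esub> \<one>\<^bsub>G\<^esub>) = differential A (\<lambda>q. p \<otimes>\<^bsub>G\<^esub> q) \<one>\<^bsub>G\<^esub> (U \<one>\<^bsub>G\<^esub>)" "V (p \<otimes>\<^bsub>G\<^esub> \<one>\<^bsub>G\<^esub>) = differential A (\<lambda>q. p \<otimes>\<^bsub>G\<^esub> q) \<one>\<^bsub>G\<^esub> (V \<one>\<^bsub>G\<^esub>)"
    using UV by (auto simp: lie_algebra_def)
  moreover have "p \<otimes>\<^bsub>G\<^esub> \<one>\<^bsub>G\<^esub> = p" by (rule r_one) (simp add: carrier_UNIV)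
  ultimately show ?thesis by simp
qed

section \<open>Application to the given Lie algebra\<close>

lemma symmetrize_fixed:
  assumes "\<And>i j. i \<noteq> j \<Longrightarrow> M i j = 0" "\<And>i. M (\<rho> i) (\<rho> i) = M i i"
  shows "symmetrize \<rho> M = M"
  using assms by (auto simp: symmetrize_def diag_def fun_eq_iff)

lemma diagonal_ricci_flow:
  fixes G :: "real \<Rightarrow> 4 \<Rightarrow> 4 \<Rightarrow> real"
  assumes flow: "\<And>i j t. 0 \<le> t \<Longrightarrow> t \<le> \<tau> \<Longrightarrow>
      ((\<lambda>s. G s i j) has_real_derivative
        - 2 * frame_ricci (G t) (gram_inverse (G t)) (Y_bracket 0 0 a3) i j) (at t within {0..\<tau>})"
    and det: "\<And>t. 0 \<le> t \<Longrightarrow> t \<le> \<tau> \<Longrightarrow> det (\<chi> i j. G t i j) \<noteq> 0"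
    and pos: "\<And>t i. 0 \<le> t \<Longrightarrow> t \<le> \<tau> \<Longrightarrow> G t i i > 0"
    and init: "G 0 = diag \<mu>" and a3: "a3 = 0 \<or> \<mu> 1 = \<mu> 2"
    and t: "0 \<le> t" "t \<le> \<tau>" and "i \<noteq> j"
  shows "G t i j = 0"
proof -
  \<comment> \<open>If \<mu> 1 = \<mu> 2, this equality becomes part of what is preserved; otherwise
    a3 = 0 and diagonality is preserved by itself.\<close>
  define \<rho> :: "4 \<Rightarrow> 4" where "\<rho> = (if \<mu> 1 = \<mu> 2 then Transposition.transpose 1 2 else id)"
  have "symmetrize \<rho> (G t) = G t"
  proof (rule ricci_flow_symmetrize[OF flow det pos _ _ _ t])
    show "\<rho> (\<rho> i) = i" for i by (simp add: \<rho>_def)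
    have "\<mu> (\<rho> i) = \<mu> i" for i by (auto simp: \<rho>_def Transposition.transpose_def)
    then show "symmetrize \<rho> (G 0) = G 0"
      unfolding init by (intro symmetrize_fixed) (auto simp: diag_def)
    fix \<nu> :: "4 \<Rightarrow> real" assume \<nu>: "\<And>i. \<nu> i > 0" "\<And>i. \<nu> (\<rho> i) = \<nu> i"
    have eq: "\<mu> 1 = \<mu> 2 \<Longrightarrow> \<nu> 1 = \<nu> 2" using \<nu>(2)[of 1] by (simp add: \<rho>_def)
    show "symmetrize \<rho> (frame_ricci (diag \<nu>) (diag (\<lambda>i. 1 / \<nu> i)) (Y_bracket 0 0 a3))
      = frame_ricci (diag \<nu>) (diag (\<lambda>i. 1 / \<nu> i)) (Y_bracket 0 0 a3)"
    proof (rule symmetrize_fixed)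
      show "frame_ricci (diag \<nu>) (diag (\<lambda>i. 1 / \<nu> i)) (Y_bracket 0 0 a3) i j = 0" if "i \<noteq> j" for i j
        using frame_ricci_off_diagonal[of \<nu>, OF \<nu>(1) _ that, of a3] a3 eq by blast
      show "frame_ricci (diag \<nu>) (diag (\<lambda>i. 1 / \<nu> i)) (Y_bracket 0 0 a3) (\<rho> i) (\<rho> i)
          = frame_ricci (diag \<nu>) (diag (\<lambda>i. 1 / \<nu> i)) (Y_bracket 0 0 a3) i i" for i
        using frame_ricci_11_22[of \<nu>, OF \<nu>(1), of a3] eq by (auto simp: \<rho>_def Transposition.transpose_def)
    qed
  qed
  then have "G t i j = symmetrize \<rho> (G t) i j" by simp
  then show ?thesis using \<open>i \<noteq> j\<close> by (simp add: symmetrize_def diag_def)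
qed

lemma invariant_frame_Y:
  fixes A :: "('g::topological_space, real ^ 4) chart set" and X :: "nat \<Rightarrow> ('g, real ^ 4) vector_field"
  assumes A: "smooth_atlas A" and X: "\<And>i. i \<in> {1..4} \<Longrightarrow> smooth_vector_field A (X i)"
    and br: "lie_bracket A (X 1) (X 4) = (\<lambda>p c. 0)" "lie_bracket A (X 2) (X 4) = (\<lambda>p c. 0)"
      "lie_bracket A (X 3) (X 4) = (\<lambda>p c. 0)" "lie_bracket A (X 2) (X 3) = X 1"
      "lie_bracket A (X 3) (X 1) = X 2" "lie_bracket A (X 1) (X 2) = (\<lambda>p c. - X 3 p c)"
    and Z: "Z 1 = X 1" "Z 2 = X 2" "Z 3 = X 3"
      "Z 4 = (\<lambda>p c. a1 *\<^sub>R X 1 p c + a2 *\<^sub>R X 2 p c + a3 *\<^sub>R X 3 p c + X 4 p c)"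
  shows "invariant_frame A Z (Y_bracket a1 a2 a3)"
proof -
  interpret smooth_manifold A by unfold_locales fact
  \<comment> \<open>Otherwise the simplifier turns \<open>X 1\<close> into \<open>X (Suc 0)\<close>,
    which the bracket equations no longer match.\<close>
  note One_nat_def [simp del]
  \<comment> \<open>Nested to the right, every partial sum is a multiple of one field plus a field,
    the shape of the linearity rules.\<close>
  have Z4: "Z 4 = (\<lambda>p c. a1 *\<^sub>R X 1 p c + (a2 *\<^sub>R X 2 p c + (a3 *\<^sub>R X 3 p c + X 4 p c)))"
    by (simp add: Z add.assoc)
  note S = smooth_vector_field_add_scaleR
  have sX: "smooth_vector_field A (X 1)" "smooth_vector_field A (X 2)"
    "smooth_vector_field A (X 3)" "smooth_vector_field A (X 4)" using X by auto
  have b4: "lie_bracket A W (Z 4) p c = a1 *\<^sub>R lie_bracket A W (X 1) p c + (a2 *\<^sub>R lie_bracket A W (X 2) p c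
      + (a3 *\<^sub>R lie_bracket A W (X 3) p c + lie_bracket A W (X 4) p c))"
    if "smooth_vector_field A W" for W p c
    by (simp add: Z4 lie_bracket_add_scaleR_right[OF _ _ that] S sX)
  have self: "lie_bracket A W W p c = 0" for W p c by (simp add: lie_bracket_def)
  have anti: "lie_bracket A (X 2) (X 1) p c = X 3 p c" "lie_bracket A (X 3) (X 2) p c = - X 1 p c"
    "lie_bracket A (X 1) (X 3) p c = - X 2 p c" for p c
    using lie_bracket_antisymmetric[of "X 2" "X 1" p c] lie_bracket_antisymmetric[of "X 3" "X 2" p c]
      lie_bracket_antisymmetric[of "X 1" "X 3" p c] br by simp_all
  have b: "lie_bracket A (X 1) (Z 4) p c = - a2 *\<^sub>R X 3 p c - a3 *\<^sub>R X 2 p c"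
    "lie_bracket A (X 2) (Z 4) p c = a1 *\<^sub>R X 3 p c + a3 *\<^sub>R X 1 p c"
    "lie_bracket A (X 3) (Z 4) p c = a1 *\<^sub>R X 2 p c - a2 *\<^sub>R X 1 p c" for p c
    by (simp_all add: b4 sX self anti br)
  have b': "lie_bracket A (Z 4) (X 1) p c = a2 *\<^sub>R X 3 p c + a3 *\<^sub>R X 2 p c"
    "lie_bracket A (Z 4) (X 2) p c = - a1 *\<^sub>R X 3 p c - a3 *\<^sub>R X 1 p c"
    "lie_bracket A (Z 4) (X 3) p c = a2 *\<^sub>R X 1 p c - a1 *\<^sub>R X 2 p c" for p c
    using lie_bracket_antisymmetric[of "Z 4" "X 1" p c] lie_bracket_antisymmetric[of "Z 4" "X 2" p c]
      lie_bracket_antisymmetric[of "Z 4" "X 3" p c] by (simp_all add: b)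
  show ?thesis
  proof
    show "smooth_vector_field A (Z i)" for i
      using exhaust_4[of i] by (elim disjE) (simp_all add: Z(1-3) Z4 S sX)
    show "lie_bracket A (Z i) (Z j) p c = (\<Sum>k\<in>UNIV. Y_bracket a1 a2 a3 i j k *\<^sub>R Z k p c)" for i j p c
      using exhaust_4[of i] exhaust_4[of j]
      by (elim disjE)
        (simp_all add: sum_4 Y_bracket_def half_bracket_def Z(1-3) b b' self anti br)
  qed
qed

text \<open>One-sided derivatives are unique as well, since 0 is not isolated in the
  interval.\<close>

lemma derivative_of_zero:
  assumes "(f has_real_derivative D) (at 0 within {0..\<tau>})" "0 < \<tau>" "\<And>s. 0 \<le> s \<Longrightarrow> s \<le> \<tau> \<Longrightarrow> f s = 0"
  shows "D = 0"
proof -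
  have "((\<lambda>_. 0) has_real_derivative D) (at 0 within {0..\<tau>})"
    by (rule has_field_derivative_transform_within[OF assms(1) assms(2)]) (use assms in auto)
  then have "((\<lambda>y. 0) \<longlongrightarrow> D) (at 0 within {0..\<tau>})"
    by (simp add: has_field_derivative_iff)
  moreover have "at 0 within {0..\<tau>} \<noteq> bot"
    using assms(2) by (simp add: at_within_Icc_at_right)
  ultimately show ?thesis
    using tendsto_unique tendsto_const by blast
qed

theorem proposition8:
  fixes G :: "'g::{t2_space, second_countable_topology} monoid"
    and A :: "('g, real ^ 4) chart set"
    and X Y :: "nat \<Rightarrow> ('g, real ^ 4) vector_field"
    and a1 a2 a3 :: real and l :: "nat \<Rightarrow> real"
    and g0 :: "('g, real ^ 4) metric" and T :: ereal and g :: "real \<Rightarrow> ('g, real ^ 4) metric"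
  assumes "lie_group G A" and "simply_connected (UNIV :: 'g set)"
    and "lie_algebra_basis G A {1..4} X"
    and "lie_bracket A (X 1) (X 4) = (\<lambda>p c. 0)"
    and "lie_bracket A (X 2) (X 4) = (\<lambda>p c. 0)"
    and "lie_bracket A (X 3) (X 4) = (\<lambda>p c. 0)"
    and "lie_bracket A (X 2) (X 3) = X 1"
    and "lie_bracket A (X 3) (X 1) = X 2"
    and "lie_bracket A (X 1) (X 2) = (\<lambda>p c. - X 3 p c)"
    and "Y 1 = X 1" and "Y 2 = X 2" and "Y 3 = X 3"
    and "Y 4 = (\<lambda>p c. a1 *\<^sub>R X 1 p c + a2 *\<^sub>R X 2 p c + a3 *\<^sub>R X 3 p c + X 4 p c)"
    and "left_invariant_metric G A g0"
    and "\<forall>i\<in>{1..4}. l i > 0"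
    and "\<forall>i\<in>{1..4}. \<forall>j\<in>{1..4}. \<forall>p. g0 p (Y i p) (Y j p) = (if i = j then l i else 0)"
    and "maximal_ricci_flow G A g0 T g"
  shows "(l 1 \<noteq> l 2 \<longrightarrow>
            ((\<forall>t\<in>flow_times T. diagonal_in (g t) {1..4} Y) \<longleftrightarrow> a1 = 0 \<and> a2 = 0 \<and> a3 = 0))
       \<and> (l 1 = l 2 \<longrightarrow>
            ((\<forall>t\<in>flow_times T. diagonal_in (g t) {1..4} Y) \<longleftrightarrow> a1 = 0 \<and> a2 = 0))"
proof -
  interpret smooth_manifold A
    by unfold_locales (rule lie_group.atlas[OF assms(1)])
  note flow = assms(17)[unfolded maximal_ricci_flow_def left_invariant_ricci_flow_def]
  note One_nat_def [simp del]
  \<comment> \<open>The fields are numbered by naturals, whereas \<open>invariant_frame\<close>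
    indexes them by the type \<open>4\<close> of the model space.\<close>
  define idx :: "4 \<Rightarrow> nat" where "idx i = (if i = 1 then 1 else if i = 2 then 2 else if i = 3 then 3 else 4)" for i
  have idx: "idx 1 = 1" "idx 2 = 2" "idx 3 = 3" "idx 4 = 4" by (simp_all add: idx_def)
  have idx_in: "idx i \<in> {1..4}" for i by (simp add: idx_def)
  have idx_inj: "idx i = idx j \<longleftrightarrow> i = j" for i j
    using exhaust_4[of i] exhaust_4[of j] by (elim disjE) (simp_all add: idx)
  have idx_surj: "\<exists>i. n = idx i" if "n \<in> {1..4}" for n
  proof -
    have "n = 1 \<or> n = 2 \<or> n = 3 \<or> n = 4" using that by auto
    then show ?thesis using idx by metis
  qed
  define Z where "Z i = Y (idx i)" for i
  have X: "X i \<in> lie_algebra G A" if "i \<in> {1..4}" for i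
    using assms(3) that unfolding lie_algebra_basis_def by blast
  then have sX: "smooth_vector_field A (X i)" if "i \<in> {1..4}" for i
    using that by (auto simp: lie_algebra_def)
  have Z: "Z 1 = X 1" "Z 2 = X 2" "Z 3 = X 3"
    "Z 4 = (\<lambda>p c. a1 *\<^sub>R X 1 p c + a2 *\<^sub>R X 2 p c + a3 *\<^sub>R X 3 p c + X 4 p c)"
    by (simp_all add: Z_def idx assms(10-13))
  interpret invariant_frame A Z "Y_bracket a1 a2 a3"
    by (rule invariant_frame_Y[OF lie_group.atlas[OF assms(1)] sX assms(4-9) Z])
  have ZT: "Z i p \<in> tangent_space A p" for i p
    using smooth by (auto simp: smooth_vector_field_def)
  have XT: "X i p \<in> tangent_space A p" if "i \<in> {1..4}" for i p
    using sX[OF that] by (auto simp: smooth_vector_field_def)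
  define e where "e = \<one>\<^bsub>G\<^esub>"

  have Z4: "Z 4 p = (\<lambda>c. a1 *\<^sub>R X 1 p c + (a2 *\<^sub>R X 2 p c + (a3 *\<^sub>R X 3 p c + X 4 p c)))" for p
    by (simp add: Z(4) add.assoc)
  \<comment> \<open>Invariance is available for products of the \<open>X i\<close>. It extends to
    \<open>Z 4\<close> by expanding one argument at a time, with coefficients independent of the
    point.\<close>
  have const: "h p (Z i p) (Z j p) = h e (Z i e) (Z j e)" if h: "left_invariant_metric G A h" for h i j p
  proof -
    have riem: "riemannian_metric A h" using h by (simp add: left_invariant_metric_def)
    note bil = metric_add_scaleR[OF riem]
    have XX: "h p (X i p) (X j p) = h e (X i e) (X j e)" if "i \<in> {1..4}" "j \<in> {1..4}" for i j p
      unfolding e_def by (rule left_invariant_metric_constant[OF assms(1) h X[OF that(1)] X[OF that(2)]])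
    have X': "X 1 p \<in> tangent_space A p" "X 2 p \<in> tangent_space A p" "X 3 p \<in> tangent_space A p"
      "X 4 p \<in> tangent_space A p" for p
      by (rule XT; simp)+
    have T: "(\<lambda>c. a3 *\<^sub>R X 3 p c + X 4 p c) \<in> tangent_space A p"
      "(\<lambda>c. a2 *\<^sub>R X 2 p c + (a3 *\<^sub>R X 3 p c + X 4 p c)) \<in> tangent_space A p" for p
      by (intro tangent_space_add_scaleR X')+
    have Z4_left: "h p (Z 4 p) w = a1 * h p (X 1 p) w + (a2 * h p (X 2 p) w + (a3 * h p (X 3 p) w + h p (X 4 p) w))"
      and Z4_right: "h p w (Z 4 p) = a1 * h p w (X 1 p) + (a2 * h p w (X 2 p) + (a3 * h p w (X 3 p) + h p w (X 4 p)))"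
      if w: "w \<in> tangent_space A p" for p w
      unfolding Z4 by (simp_all only: bil[OF X'(1) T(2) w] bil[OF X'(2) T(1) w] bil[OF X'(3,4) w])
    have ZX: "h p (Z i p) (X j p) = h e (Z i e) (X j e)" if j: "j \<in> {1..4}" for i j p
      using exhaust_4[of i]
      by (elim disjE) (simp_all add: Z(1-3) Z4_left XT[OF j] XX[OF _ j, of _ p])
    show ?thesis
      using exhaust_4[of j]
      by (elim disjE) (simp_all add: Z(1-3) Z4_right ZT ZX[of _ p i])
  qed

  have g0: "g0 p (Z i p) (Z j p) = (if i = j then l (idx i) else 0)" for i j p
    using assms(16) idx_in[of i] idx_in[of j] by (simp add: Z_def idx_inj)
  \<comment> \<open>The basis hypothesis concerns fields, whereas independence is wanted at one
    point. It follows from \<open>g0\<close>, which is diagonal there with positive entries.\<close>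
  have ind: "r i = 0" if "(\<lambda>c. \<Sum>i\<in>UNIV. r i *\<^sub>R Z i e c) = (\<lambda>c. 0)" for r i
  proof -
    have riem: "riemannian_metric A g0" using assms(14) by (simp add: left_invariant_metric_def)
    have "(\<Sum>j\<in>UNIV. r j * g0 e (Z j e) (Z i e)) = g0 e (\<lambda>c. \<Sum>j\<in>UNIV. r j *\<^sub>R Z j e c) (Z i e)"
      by (rule metric_sum[OF riem, symmetric]) (simp_all add: ZT)
    also have "\<dots> = g0 e (\<lambda>c. \<Sum>j\<in>(UNIV :: 4 set). 0 *\<^sub>R Z j e c) (Z i e)" by (simp add: that)
    also have "\<dots> = (\<Sum>j\<in>UNIV. 0 * g0 e (Z j e) (Z i e))"
      by (rule metric_sum[OF riem]) (simp_all add: ZT)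
    finally have "r i * l (idx i) = 0"
      by (simp add: g0 if_distrib[of "\<lambda>x. _ * x"] cong: if_cong)
    moreover have "l (idx i) > 0" using assms(15) idx_in by blast
    ultimately show ?thesis by simp
  qed

  \<comment> \<open>By \<open>const\<close>, the Gram matrix at the identity is the Gram matrix at
    every point.\<close>
  define M where "M t i j = g t e (Z i e) (Z j e)" for t i j
  have lim: "left_invariant_metric G A (g t)" and riem: "riemannian_metric A (g t)" if "t \<in> flow_times T" for t
    using flow that by (auto simp: left_invariant_metric_def)
  have M: "g t p (Z i p) (Z j p) = M t i j" if "t \<in> flow_times T" for t i j p
    using const[OF lim[OF that]] by (simp add: M_def)
  have det: "det (\<chi> i j. M t i j) \<noteq> 0" if "t \<in> flow_times T" for t
    unfolding M_def by (rule gram_det_nonzero[OF riem[OF that] ZT]) (rule ind)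
  have pos: "M t i i > 0" if "t \<in> flow_times T" for t i
  proof -
    have "Z i e \<noteq> (\<lambda>c. 0)"
    proof
      assume "Z i e = (\<lambda>c. 0)"
      then have "(\<lambda>c. \<Sum>j\<in>UNIV. (if j = i then 1 else 0) *\<^sub>R Z j e c) = (\<lambda>c. 0)"
        by (simp add: if_distrib[of "\<lambda>x. x *\<^sub>R _"] cong: if_cong)
      from ind[OF this, of i] show False by simp
    qed
    then show ?thesis
      using riem[OF that] ZT[of i e] unfolding M_def riemannian_metric_def by blast
  qed
  have times: "s \<in> flow_times T" if "t \<in> flow_times T" "0 \<le> s" "s \<le> t" for s t
    using that by (auto simp: flow_times_def intro: le_less_trans[of "ereal s" "ereal t"])
  have deriv: "((\<lambda>s. M s i j) has_real_derivative
      - 2 * frame_ricci (M t) (gram_inverse (M t)) (Y_bracket a1 a2 a3) i j) (at t within {0..\<tau>})"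
    if "\<tau> \<in> flow_times T" "0 \<le> t" "t \<le> \<tau>" for i j t \<tau>
  proof -
    have t: "t \<in> flow_times T" by (rule times[OF that])
    have "ricci A (g t) e (Z i e) (Z j e) = frame_ricci (M t) (gram_inverse (M t)) (Y_bracket a1 a2 a3) i j"
      by (rule ricci_frame[OF riem[OF t] M[OF t] gram_inverse(2,1)[OF det[OF t]]])
    moreover have "((\<lambda>s. M s i j) has_real_derivative (- 2 * ricci A (g t) e (Z i e) (Z j e)))
        (at t within flow_times T)"
      unfolding M_def using flow t ZT by blast
    moreover have "{0..\<tau>} \<subseteq> flow_times T"
      using times[OF that(1)] by auto
    ultimately show ?thesis
      using DERIV_subset by metis
  qed

  define \<mu> where "\<mu> i = l (idx i)" for i
  have \<mu>: "\<mu> i > 0" for i using assms(15) idx_in by (auto simp: \<mu>_def)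
  have "\<exists>\<tau>>0. \<tau> \<in> flow_times T"
    using ereal_dense2[of 0 T] flow by (auto simp: flow_times_def)
  then obtain \<tau> where \<tau>: "\<tau> > 0" "\<tau> \<in> flow_times T" by blast
  have init: "M 0 = diag \<mu>"
    using flow ZT g0 unfolding metric_eq_def by (auto simp: M_def diag_def \<mu>_def fun_eq_iff)
  have ginit: "gram_inverse (M 0) = diag (\<lambda>i. 1 / \<mu> i)"
    unfolding init by (rule gram_inverse_diag) (use \<mu> in \<open>simp add: less_imp_neq[symmetric]\<close>)

  have diagonal: "diagonal_in (g t) {1..4} Y \<longleftrightarrow> (\<forall>i j. i \<noteq> j \<longrightarrow> M t i j = 0)" if t: "t \<in> flow_times T" for t
  proof
    assume "diagonal_in (g t) {1..4} Y"
    then show "\<forall>i j. i \<noteq> j \<longrightarrow> M t i j = 0"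
      using idx_in idx_inj unfolding diagonal_in_def M_def Z_def by blast
  next
    assume *: "\<forall>i j. i \<noteq> j \<longrightarrow> M t i j = 0"
    show "diagonal_in (g t) {1..4} Y"
      unfolding diagonal_in_def
    proof (intro ballI impI allI)
      fix m n p assume mn: "m \<in> {1..4}" "n \<in> {1..4}" "m \<noteq> (n :: nat)"
      obtain i j where "m = idx i" "n = idx j" using idx_surj mn by meson
      then show "g t p (Y m p) (Y n p) = 0"
        using * mn(3) M[OF t, of p i j] by (cases "i = j") (simp_all add: Z_def)
    qed
  qed

  have necessary: "a1 = 0 \<and> a2 = 0 \<and> (a3 = 0 \<or> \<mu> 1 = \<mu> 2)"
    if "\<forall>t\<in>flow_times T. diagonal_in (g t) {1..4} Y"
  proof -
    have "frame_ricci (diag \<mu>) (diag (\<lambda>i. 1 / \<mu> i)) (Y_bracket a1 a2 a3) i j = 0" if ij: "i \<noteq> j" for i j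
    proof -
      have "M s i j = 0" if "0 \<le> s" "s \<le> \<tau>" for s
        using \<open>\<forall>t\<in>flow_times T. _ t\<close> diagonal times[OF \<tau>(2) that] ij by blast
      \<comment> \<open>An entry that vanishes on \<open>{0..\<tau>}\<close> has right derivative 0
        at time 0, so the initial Ricci tensor has no entries off the diagonal.\<close>
      then have "- 2 * frame_ricci (M 0) (gram_inverse (M 0)) (Y_bracket a1 a2 a3) i j = 0"
        using \<tau> by (intro derivative_of_zero[OF deriv[OF \<tau>(2)] \<tau>(1)]) auto
      then show ?thesis unfolding ginit unfolding init by simp
    qed
    from this[of 1 4] this[of 2 4] this[of 3 4] show ?thesis
      unfolding frame_ricci_14[of \<mu>, OF \<mu>] frame_ricci_24[of \<mu>, OF \<mu>] frame_ricci_34[of \<mu>, OF \<mu>]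
      using \<mu>[of 1] \<mu>[of 2] \<mu>[of 3] by simp
  qed
  have sufficient: "diagonal_in (g t) {1..4} Y"
    if a: "a1 = 0" "a2 = 0" "a3 = 0 \<or> \<mu> 1 = \<mu> 2" and t: "t \<in> flow_times T" for t
  proof -
    have "M t i j = 0" if "i \<noteq> j" for i j
    \<comment> \<open>The Lipschitz constants come from compactness, so each \<open>t\<close> is
      treated on its own interval \<open>{0..t}\<close> inside the flow times.\<close>
    proof (rule diagonal_ricci_flow[where G = M and t = t and \<tau> = t and \<mu> = \<mu> and ?a3.0 = a3])
      show "((\<lambda>s. M s i j) has_real_derivative
          - 2 * frame_ricci (M s) (gram_inverse (M s)) (Y_bracket 0 0 a3) i j) (at s within {0..t})"
        if "0 \<le> s" "s \<le> t" for i j s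
        using deriv[OF t that] a by simp
    qed (use det pos times[OF t] init a t that in \<open>auto simp: flow_times_def\<close>)
    then show ?thesis using diagonal[OF t] by blast
  qed
  have "\<mu> 1 = l 1" "\<mu> 2 = l 2" by (simp_all add: \<mu>_def idx)
  then show ?thesis using necessary sufficient by metis
qed

end
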